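(* Let $X$ be a Banach space, $U$ a normed linear space, and let $A$ be the generator of a $C_0$-semigroup on $X$. Let $f$ be an $X$-valued function defined on an open set $Q\subset X\times U$ with $(0,0)\in Q$ and $f(0,0)=0$, and suppose that $f(x,u)=Bx+Cu+g(x,u)$ with $B\in L(X)$, $C\in L(U,X)$, where for each $w>0$ there exists $\rho>0$ such that for all $x$ with $\|x\|_X\le\rho$ and all $u$ with $\|u\|_U\le\rho$ $$\|g(x,u)\|_X\le w(\|x\|_X+\|u\|_U).$$ Consider the nonlinear control system $$\dot x(t)=Ax(t)+f(x(t),u(t)),\qquad x(t)\in X,\ u(t)\in U,$$ and its linear approximation $$\dot x=Rx+Cu,\qquad R=A+B .$$ If the linear system $\dot x=Rx+Cu$ is input-to-state stable (ISS), then the nonlinear system is locally input-to-state stable (LISS).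
   Context: $L(U,X)$ is the space of bounded linear operators $U\to X$, $L(X)=L(X,X)$. The operator $R=A+B$, $D(R)=D(A)$, generates a $C_0$-semigroup. Inputs: $U_c$ is a linear space of bounded strongly measurable functions $u:\mathbb{R}_+\to U$ (e.g. piecewise right-continuous or continuous functions), with norm $\|u\|_{U_c}=\sup_{s\ge0}\|u(s)\|_U$. Solutions are mild solutions: with $S$ the semigroup generated by $A$, $x(t)=S(t)x_0+\int_0^tS(t-s)f(x(s),u(s))\,ds$ for the nonlinear system, and with $T$ the semigroup generated by $R$, $x(t)=T(t)x_0+\int_0^tT(t-s)Cu(s)\,ds$ for the linear one (Bochner integrals). Write $\phi(t,x_0,u)$ for the solution with initial state $x_0$ at time $0$ and input $u\in U_c$. It is a standing assumption that these equations define time-invariant control systems $(X,U_c,\phi)$: a solution exists (locally in time) and is unique, is continuous in $t$, depends on $u$ only through its values up to the current time, has the semigroup (cocycle) property, and the BIC property holds: there is a maximal existence time $t_m\in(0,\infty]$, and if $t_m<\infty$ then $\|\phi(t,x_0,u)\|_X$ is unbounded on $[0,t_m)$. $\mathcal K$: continuous strictly increasing $\gamma:\mathbb{R}_+\to\mathbb{R}_+$ with $\gamma(0)=0$. $\mathcal{KL}$: functions $\beta:\mathbb{R}_+^2\to\mathbb{R}_+$ with $\beta(\cdot,t)\in\mathcal K$ for each $t\ge0$ and $\beta(r,\cdot)$ continuous, decreasing, tending to $0$ at infinity for each $r>0$. LISS: there exist $\rho_x,\rho_u>0$, $\beta\in\mathcal{KL}$, $\gamma\in\mathcal K$ such that for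 all $x_0$ with $\|x_0\|_X\le\rho_x$, all $u\in U_c$ with $\|u\|_{U_c}\le\rho_u$ and all $t\ge0$, $\phi(t,x_0,u)$ is defined and $\|\phi(t,x_0,u)\|_X\le\beta(\|x_0\|_X,t)+\gamma(\|u\|_{U_c})$. ISS: the same with $\rho_x=\rho_u=\infty$. *)

theory Defs
  imports "HOL-Analysis.Analysis"
begin

(* The library's Bochner integral (has_bochner_integral) is restricted to second countable, i.e.
   separable, value spaces. Here the value space is an arbitrary normed space, so Borel
   measurability is replaced by strong measurability; the remaining conditions are unchanged. *)

definition strongly_measurable :: "'a measure \<Rightarrow> ('a \<Rightarrow> 'b::real_normed_vector) \<Rightarrow> bool" where
  "strongly_measurable M f \<longleftrightarrow>
     (\<exists>s. (\<forall>i::nat. simple_function M (s i)) \<and> (AE x in M. (\<lambda>i. s i x) \<longlonglongrightarrow> f x))"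

definition has_strong_bochner_integral ::
    "'a measure \<Rightarrow> ('a \<Rightarrow> 'b::real_normed_vector) \<Rightarrow> 'b \<Rightarrow> bool" where
  "has_strong_bochner_integral M f I \<longleftrightarrow>
     strongly_measurable M f \<and>
     (\<exists>s. (\<forall>i::nat. Bochner_Integration.simple_bochner_integrable M (s i)) \<and>
          ((\<lambda>i. \<integral>\<^sup>+ x. ennreal (norm (f x - s i x)) \<partial>M) \<longlonglongrightarrow> 0) \<and>
          ((\<lambda>i. Bochner_Integration.simple_bochner_integral M (s i)) \<longlonglongrightarrow> I))"

lemma strongly_measurable_iff_borel_measurable:
  fixes f :: "'a \<Rightarrow> 'b::{real_normed_vector, second_countable_topology}"
  assumes "complete_measure M"
  shows "strongly_measurable M f \<longleftrightarrow> f \<in> borel_measurable M"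
proof
  assume "strongly_measurable M f"
  then obtain s where s: "\<And>i::nat. simple_function M (s i)"
      and lim: "AE x in M. (\<lambda>i. s i x) \<longlonglongrightarrow> f x"
    unfolding strongly_measurable_def by blast
  obtain N where N: "N \<in> null_sets M" "{x\<in>space M. \<not> (\<lambda>i. s i x) \<longlonglongrightarrow> f x} \<subseteq> N"
    using lim unfolding eventually_ae_filter by blast
  define h where "h = (\<lambda>x. if x \<in> N then 0 else f x)"
  have h: "h \<in> borel_measurable M"
  proof (rule borel_measurable_LIMSEQ_metric)
    fix i
    show "(\<lambda>x. if x \<in> N then 0 else s i x) \<in> borel_measurable M"
      using N(1) borel_measurable_simple_function[OF s[of i]]
      by (intro measurable_If_set) (auto simp: null_sets_def)
  next
    fix x assume "x \<in> space M"
    then show "(\<lambda>i. if x \<in> N then 0 else s i x) \<longlonglongrightarrow> h x"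
      using N(2) by (auto simp: h_def)
  qed
  show "f \<in> borel_measurable M"
  proof (rule measurableI)
    fix Y :: "'b set" assume "Y \<in> sets borel"
    then have hY: "h -` Y \<inter> space M \<in> sets M"
      by (rule measurable_sets[OF h])
    have ae: "AE x in M. x \<in> h -` Y \<inter> space M \<longleftrightarrow> x \<in> f -` Y \<inter> space M"
      by (rule AE_I'[OF N(1)]) (auto simp: h_def)
    show "f -` Y \<inter> space M \<in> sets M"
      by (rule complete_measure.in_sets_AE[OF assms ae hY Int_lower2])
  qed simp
next
  assume "f \<in> borel_measurable M"
  then obtain s where "\<And>i. simple_function M (s i)"
      and "\<And>x. x \<in> space M \<Longrightarrow> (\<lambda>i. s i x) \<longlonglongrightarrow> f x"
    using borel_measurable_implies_sequence_metric[of f M 0] by metis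
  then show "strongly_measurable M f"
    unfolding strongly_measurable_def by (intro exI[of _ s]) auto
qed

lemma has_strong_bochner_integral_iff:
  fixes f :: "'a \<Rightarrow> 'b::{real_normed_vector, second_countable_topology}"
  assumes "complete_measure M"
  shows "has_strong_bochner_integral M f I \<longleftrightarrow> has_bochner_integral M f I"
  unfolding has_strong_bochner_integral_def strongly_measurable_iff_borel_measurable[OF assms]
  by (subst has_bochner_integral.simps) auto


definition c0_semigroup :: "(real \<Rightarrow> 'x::real_normed_vector \<Rightarrow>\<^sub>L 'x) \<Rightarrow> bool" where
  "c0_semigroup T \<longleftrightarrow>
     T 0 = id_blinfun \<and>
     (\<forall>s\<ge>0. \<forall>t\<ge>0. T (s + t) = T s o\<^sub>L T t) \<and>
     (\<forall>x. ((\<lambda>t. T t x) \<longlongrightarrow> x) (at_right 0))"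

(* The operator A with domain D (its values off D are irrelevant) is the generator of T. *)

definition generates ::
    "'x set \<Rightarrow> ('x \<Rightarrow> 'x) \<Rightarrow> (real \<Rightarrow> 'x::real_normed_vector \<Rightarrow>\<^sub>L 'x) \<Rightarrow> bool" where
  "generates D A T \<longleftrightarrow>
     c0_semigroup T \<and>
     (\<forall>x y. x \<in> D \<and> A x = y \<longleftrightarrow> ((\<lambda>h. (T h x - x) /\<^sub>R h) \<longlongrightarrow> y) (at_right 0))"


(* Inputs are total functions on the reals of which only the values on {0..} are ever used. *)

definition input_space :: "(real \<Rightarrow> 'u::real_normed_vector) set \<Rightarrow> bool" where
  "input_space Uc \<longleftrightarrow>
     (\<lambda>_. 0) \<in> Uc \<and>
     (\<forall>u\<in>Uc. \<forall>v\<in>Uc. (\<lambda>s. u s + v s) \<in> Uc) \<and>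
     (\<forall>c. \<forall>u\<in>Uc. (\<lambda>s. c *\<^sub>R u s) \<in> Uc) \<and>
     (\<forall>u\<in>Uc. bounded (u ` {0..}) \<and> strongly_measurable (lebesgue_on {0..}) u)"

definition input_norm :: "(real \<Rightarrow> 'u::real_normed_vector) \<Rightarrow> real" where
  "input_norm u = (SUP s\<in>{0..}. norm (u s))"

(* x is a mild solution on [0,\<tau>) of x' = A x + f(x,u), x(0) = x0, where A generates S and f is
   defined on Q only. *)

definition mild_solution ::
    "(real \<Rightarrow> 'x::real_normed_vector \<Rightarrow>\<^sub>L 'x) \<Rightarrow> ('x \<times> 'u::real_normed_vector) set \<Rightarrow>
     ('x \<Rightarrow> 'u \<Rightarrow> 'x) \<Rightarrow> 'x \<Rightarrow> (real \<Rightarrow> 'u) \<Rightarrow> ereal \<Rightarrow> (real \<Rightarrow> 'x) \<Rightarrow> bool" where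
  "mild_solution S Q f x0 u \<tau> x \<longleftrightarrow>
     continuous_on {t. 0 \<le> t \<and> ereal t < \<tau>} x \<and>
     (\<forall>t. 0 \<le> t \<and> ereal t < \<tau> \<longrightarrow>
        (x t, u t) \<in> Q \<and>
        has_strong_bochner_integral (lebesgue_on {0..t})
          (\<lambda>s. S (t - s) (f (x s) (u s))) (x t - S t x0))"

definition uniformly_inside ::
    "('x::real_normed_vector \<times> 'u::real_normed_vector) set \<Rightarrow> real set \<Rightarrow>
     (real \<Rightarrow> 'x) \<Rightarrow> (real \<Rightarrow> 'u) \<Rightarrow> bool" where
  "uniformly_inside Q I x u \<longleftrightarrow>
     (\<exists>r>0. \<exists>\<delta>>0. \<forall>s\<in>I. \<forall>\<sigma>\<in>{s..<s + \<delta>}. ball (x s, u \<sigma>) r \<subseteq> Q)"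

lemma uniformly_inside_UNIV [simp]: "uniformly_inside UNIV I x u"
  unfolding uniformly_inside_def using zero_less_one by blast

(* The equation x' = A x + f(x,u) defines the time-invariant control system with solution map \<phi>
   and maximal existence times tm: the solution from x0 under u lives on [0, tm x0 u).
   The conjuncts are: \<phi> is a mild solution; uniqueness and maximality; local existence; bounded
   implies continuation; causality; cocycle property.
   If Q is the whole space, the two uniformly_inside guards hold trivially, and then tm is positive
   for all data, and every solution with finite maximal existence time is unbounded. If Q is a
   proper subset, then f may be undefined at (x0, u 0), and a solution may also end by reaching the
   boundary of Q; the guards exempt such data. Where no solution exists at all, tm is 0. *)

definition control_system ::
    "(real \<Rightarrow> 'x::real_normed_vector \<Rightarrow>\<^sub>L 'x) \<Rightarrow> ('x \<times> 'u::real_normed_vector) set \<Rightarrow>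
     ('x \<Rightarrow> 'u \<Rightarrow> 'x) \<Rightarrow> (real \<Rightarrow> 'u) set \<Rightarrow>
     (real \<Rightarrow> 'x \<Rightarrow> (real \<Rightarrow> 'u) \<Rightarrow> 'x) \<Rightarrow> ('x \<Rightarrow> (real \<Rightarrow> 'u) \<Rightarrow> ereal) \<Rightarrow> bool" where
  "control_system S Q f Uc \<phi> tm \<longleftrightarrow>
     (\<forall>x0. \<forall>u\<in>Uc.
        0 \<le> tm x0 u \<and>
        mild_solution S Q f x0 u (tm x0 u) (\<lambda>t. \<phi> t x0 u) \<and>
        (\<forall>\<tau> x. mild_solution S Q f x0 u \<tau> x \<longrightarrow>
           \<tau> \<le> tm x0 u \<and> (\<forall>t. 0 \<le> t \<and> ereal t < \<tau> \<longrightarrow> x t = \<phi> t x0 u)) \<and>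
        (uniformly_inside Q {0} (\<lambda>_. x0) u \<longrightarrow> 0 < tm x0 u) \<and>
        (0 < tm x0 u \<and> tm x0 u < \<infinity> \<and>
           uniformly_inside Q {t. 0 \<le> t \<and> ereal t < tm x0 u} (\<lambda>t. \<phi> t x0 u) u \<longrightarrow>
           \<not> bounded ((\<lambda>t. \<phi> t x0 u) ` {t. 0 \<le> t \<and> ereal t < tm x0 u})) \<and>
        (\<forall>v\<in>Uc. \<forall>t. 0 \<le> t \<and> ereal t < tm x0 u \<and> ereal t < tm x0 v \<and> (\<forall>s\<in>{0..t}. u s = v s) \<longrightarrow>
           \<phi> t x0 u = \<phi> t x0 v) \<and>
        (\<forall>v\<in>Uc. \<forall>t\<ge>0. \<forall>h\<ge>0. ereal (t + h) < tm x0 u \<and> (\<forall>s\<ge>0. v s = u (t + s)) \<longrightarrow>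
           ereal h < tm (\<phi> t x0 u) v \<and> \<phi> h (\<phi> t x0 u) v = \<phi> (t + h) x0 u))"


definition class_K :: "(real \<Rightarrow> real) set" where
  "class_K = {\<gamma>. continuous_on {0..} \<gamma> \<and> strict_mono_on {0..} \<gamma> \<and> \<gamma> 0 = 0}"

definition class_KL :: "(real \<Rightarrow> real \<Rightarrow> real) set" where
  "class_KL = {\<beta>. (\<forall>t\<ge>0. (\<lambda>r. \<beta> r t) \<in> class_K) \<and>
                  (\<forall>r>0. continuous_on {0..} (\<beta> r) \<and> antimono_on {0..} (\<beta> r) \<and>
                          (\<beta> r \<longlongrightarrow> 0) at_top)}"

definition iss_estimate ::
    "(real \<Rightarrow> 'x::real_normed_vector \<Rightarrow> (real \<Rightarrow> 'u::real_normed_vector) \<Rightarrow> 'x) \<Rightarrow>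
     ('x \<Rightarrow> (real \<Rightarrow> 'u) \<Rightarrow> ereal) \<Rightarrow> (real \<Rightarrow> real \<Rightarrow> real) \<Rightarrow> (real \<Rightarrow> real) \<Rightarrow>
     'x \<Rightarrow> (real \<Rightarrow> 'u) \<Rightarrow> bool" where
  "iss_estimate \<phi> tm \<beta> \<gamma> x0 u \<longleftrightarrow>
     (\<forall>t\<ge>0. ereal t < tm x0 u \<and> norm (\<phi> t x0 u) \<le> \<beta> (norm x0) t + \<gamma> (input_norm u))"

definition LISS ::
    "(real \<Rightarrow> 'u::real_normed_vector) set \<Rightarrow> (real \<Rightarrow> 'x::real_normed_vector \<Rightarrow> (real \<Rightarrow> 'u) \<Rightarrow> 'x) \<Rightarrow>
     ('x \<Rightarrow> (real \<Rightarrow> 'u) \<Rightarrow> ereal) \<Rightarrow> bool" where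
  "LISS Uc \<phi> tm \<longleftrightarrow>
     (\<exists>\<rho>x>0. \<exists>\<rho>u>0. \<exists>\<beta>\<in>class_KL. \<exists>\<gamma>\<in>class_K.
        \<forall>x0. \<forall>u\<in>Uc. norm x0 \<le> \<rho>x \<and> input_norm u \<le> \<rho>u \<longrightarrow> iss_estimate \<phi> tm \<beta> \<gamma> x0 u)"

definition ISS ::
    "(real \<Rightarrow> 'u::real_normed_vector) set \<Rightarrow> (real \<Rightarrow> 'x::real_normed_vector \<Rightarrow> (real \<Rightarrow> 'u) \<Rightarrow> 'x) \<Rightarrow>
     ('x \<Rightarrow> (real \<Rightarrow> 'u) \<Rightarrow> ereal) \<Rightarrow> bool" where
  "ISS Uc \<phi> tm \<longleftrightarrow>
     (\<exists>\<beta>\<in>class_KL. \<exists>\<gamma>\<in>class_K. \<forall>x0. \<forall>u\<in>Uc. iss_estimate \<phi> tm \<beta> \<gamma> x0 u)"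

end

theory Submission
  imports Defs
begin

text \<open>
  ISS of the linear system with zero input makes \<open>T\<close> exponentially stable, so
  \<open>|x| = sup_t exp (\<omega> t) \<parallel>T(t) x\<parallel>\<close> is an equivalent norm with
  \<open>|T(k) x| \<le> exp (- \<omega> k) |x|\<close>. Instead of a variation of constants formula for \<open>T\<close> (which would
  need measurability of \<open>f(x(s), u(s))\<close> itself), only an infinitesimal version is used: since
  \<open>(T(k) y - S(k) y) / k \<longlonglongrightarrow> B y\<close> for every \<open>y\<close>, a mild solution satisfies
  \<open>\<parallel>x(s + k) - T(k) x(s)\<parallel> \<le> k (N H + o(1))\<close>, where \<open>H\<close> bounds \<open>C u + g(x, u)\<close> near \<open>s\<close> and \<open>N\<close> bounds
  \<open>S\<close> near \<open>0\<close>. For small states this is a differential inequality for \<open>|x(t)|\<close>, which a barrier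
  \<open>exp (- \<omega> t / 2) |x0| + K \<parallel>u\<parallel>\<close> dominates; the resulting bound keeps the solution away from the
  boundary of \<open>Q\<close>, so it is global.
\<close>

section \<open>Strong Bochner integrals\<close>

text \<open>Taking norms lands in the reals, where strong measurability over a complete measure is
  Borel measurability. This supplies the measurability premises of the \<open>nn_integral\<close>
  rules applied to approximation errors below.\<close>

lemma strongly_measurable_norm_diff:
  assumes "complete_measure M" "strongly_measurable M f" "simple_function M s"
  shows "(\<lambda>x. norm (f x - s x)) \<in> borel_measurable M"
proof -
  obtain s' where s': "\<And>i::nat. simple_function M (s' i)"
      and lim: "AE x in M. (\<lambda>i. s' i x) \<longlonglongrightarrow> f x"
    using assms(2) unfolding strongly_measurable_def by blast
  have "strongly_measurable M (\<lambda>x. norm (f x - s x))"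
    unfolding strongly_measurable_def
  proof (intro exI[of _ "\<lambda>i x. norm (s' i x - s x)"] conjI allI)
    show "simple_function M (\<lambda>x. norm (s' i x - s x))" for i
      by (rule simple_function_compose2[OF s' assms(3)])
    show "AE x in M. (\<lambda>i. norm (s' i x - s x)) \<longlonglongrightarrow> norm (f x - s x)"
      using lim by eventually_elim (intro tendsto_intros)
  qed
  then show ?thesis
    by (simp add: strongly_measurable_iff_borel_measurable[OF assms(1)])
qed

text \<open>Each simple approximant satisfies the bound up to its own L1 error, because
  \<open>norm (s i x)\<close> is at most \<open>norm (f x)\<close> plus the error at
  \<open>x\<close>; the errors vanish in the limit. A separate majorant \<open>q\<close> allows the
  bound to be a constant on an interval.\<close>

lemma has_strong_bochner_integral_norm_le:
  fixes q :: "'a \<Rightarrow> ennreal"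
  assumes M: "complete_measure M" and f: "has_strong_bochner_integral M f I"
    and q[measurable]: "q \<in> borel_measurable M"
    and le: "\<And>x. x \<in> space M \<Longrightarrow> ennreal (norm (f x)) \<le> q x"
  shows "ennreal (norm I) \<le> (\<integral>\<^sup>+ x. q x \<partial>M)"
proof -
  obtain s where s: "\<And>i::nat. Bochner_Integration.simple_bochner_integrable M (s i)"
      and lim: "(\<lambda>i. \<integral>\<^sup>+ x. ennreal (norm (f x - s i x)) \<partial>M) \<longlonglongrightarrow> 0"
      and limI: "(\<lambda>i. Bochner_Integration.simple_bochner_integral M (s i)) \<longlonglongrightarrow> I"
      and sm: "strongly_measurable M f"
    using f unfolding has_strong_bochner_integral_def by blast
  have [measurable]: "(\<lambda>x. norm (f x - s i x)) \<in> borel_measurable M" for i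
    using s[of i] by (intro strongly_measurable_norm_diff[OF M sm])
      (auto elim: Bochner_Integration.simple_bochner_integrable.cases)
  have le_i: "ennreal (norm (Bochner_Integration.simple_bochner_integral M (s i))) \<le>
      (\<integral>\<^sup>+ x. q x \<partial>M) + (\<integral>\<^sup>+ x. ennreal (norm (f x - s i x)) \<partial>M)" for i
  proof -
    have "ennreal (norm (Bochner_Integration.simple_bochner_integral M (s i)))
        \<le> Bochner_Integration.simple_bochner_integral M (\<lambda>x. norm (s i x))"
      using s[of i] by (intro ennreal_leI simple_bochner_integral_norm_bound)
    also have "\<dots> = (\<integral>\<^sup>+ x. ennreal (norm (s i x)) \<partial>M)"
      using simple_bochner_integrable_compose2[of "\<lambda>x y. norm x" M "s i" "s i"] s
      by (intro simple_bochner_integral_eq_nn_integral) auto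
    also have "\<dots> \<le> (\<integral>\<^sup>+ x. q x + ennreal (norm (f x - s i x)) \<partial>M)"
    proof (rule nn_integral_mono)
      fix x assume x: "x \<in> space M"
      have "ennreal (norm (s i x)) \<le> ennreal (norm (f x) + norm (f x - s i x))"
        by (intro ennreal_leI) (metis norm_minus_commute norm_triangle_sub)
      also have "\<dots> = ennreal (norm (f x)) + ennreal (norm (f x - s i x))"
        by simp
      finally show "ennreal (norm (s i x)) \<le> q x + ennreal (norm (f x - s i x))"
        using le[OF x] by (meson add_right_mono order_trans)
    qed
    also have "\<dots> = (\<integral>\<^sup>+ x. q x \<partial>M) + (\<integral>\<^sup>+ x. ennreal (norm (f x - s i x)) \<partial>M)"
      by (rule nn_integral_add) measurable
    finally show ?thesis .
  qed
  have "(\<lambda>i. ennreal (norm (Bochner_Integration.simple_bochner_integral M (s i)))) \<longlonglongrightarrow> ennreal (norm I)"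
    by (intro tendsto_intros limI)
  moreover have "(\<lambda>i. (\<integral>\<^sup>+ x. q x \<partial>M) + (\<integral>\<^sup>+ x. ennreal (norm (f x - s i x)) \<partial>M))
      \<longlonglongrightarrow> (\<integral>\<^sup>+ x. q x \<partial>M) + 0"
    by (intro tendsto_add tendsto_const lim)
  ultimately show ?thesis
    using LIMSEQ_le le_i by fastforce
qed

lemma has_strong_bochner_integral_diff:
  assumes M: "complete_measure M"
    and f: "has_strong_bochner_integral M f I" and g: "has_strong_bochner_integral M g J"
  shows "has_strong_bochner_integral M (\<lambda>x. f x - g x) (I - J)"
proof -
  obtain s where s: "\<And>i::nat. Bochner_Integration.simple_bochner_integrable M (s i)"
      and lims: "(\<lambda>i. \<integral>\<^sup>+ x. ennreal (norm (f x - s i x)) \<partial>M) \<longlonglongrightarrow> 0"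
      and limI: "(\<lambda>i. Bochner_Integration.simple_bochner_integral M (s i)) \<longlonglongrightarrow> I"
      and smf: "strongly_measurable M f"
    using f unfolding has_strong_bochner_integral_def by blast
  obtain t where t: "\<And>i::nat. Bochner_Integration.simple_bochner_integrable M (t i)"
      and limt: "(\<lambda>i. \<integral>\<^sup>+ x. ennreal (norm (g x - t i x)) \<partial>M) \<longlonglongrightarrow> 0"
      and limJ: "(\<lambda>i. Bochner_Integration.simple_bochner_integral M (t i)) \<longlonglongrightarrow> J"
      and smg: "strongly_measurable M g"
    using g unfolding has_strong_bochner_integral_def by blast
  have [measurable]: "(\<lambda>x. norm (f x - s i x)) \<in> borel_measurable M"
      "(\<lambda>x. norm (g x - t i x)) \<in> borel_measurable M" for i
    using s[of i] t[of i] smf smg by (auto intro!: strongly_measurable_norm_diff[OF M]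
      elim: Bochner_Integration.simple_bochner_integrable.cases)
  have "strongly_measurable M (\<lambda>x. f x - g x)"
  proof -
    obtain s' t' where st: "\<And>i::nat. simple_function M (s' i)" "\<And>i::nat. simple_function M (t' i)"
      and l1: "AE x in M. (\<lambda>i. s' i x) \<longlonglongrightarrow> f x" and l2: "AE x in M. (\<lambda>i. t' i x) \<longlonglongrightarrow> g x"
      using smf smg unfolding strongly_measurable_def by blast
    show ?thesis
      unfolding strongly_measurable_def
    proof (intro exI[of _ "\<lambda>i x. s' i x - t' i x"] conjI allI)
      show "simple_function M (\<lambda>x. s' i x - t' i x)" for i
        by (rule simple_function_compose2[OF st])
      show "AE x in M. (\<lambda>i. s' i x - t' i x) \<longlonglongrightarrow> f x - g x"
        using l1 l2 by eventually_elim (intro tendsto_intros)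
    qed
  qed
  moreover have "(\<lambda>i. \<integral>\<^sup>+ x. ennreal (norm (f x - g x - (s i x - t i x))) \<partial>M) \<longlonglongrightarrow> 0"
  proof (rule tendsto_sandwich[OF _ _ tendsto_const])
    show "\<forall>\<^sub>F i in sequentially. (\<integral>\<^sup>+ x. ennreal (norm (f x - g x - (s i x - t i x))) \<partial>M) \<le>
        (\<integral>\<^sup>+ x. ennreal (norm (f x - s i x)) \<partial>M) + (\<integral>\<^sup>+ x. ennreal (norm (g x - t i x)) \<partial>M)"
    proof (intro always_eventually allI)
      fix i
      have "(\<integral>\<^sup>+ x. ennreal (norm (f x - g x - (s i x - t i x))) \<partial>M) \<le>
        (\<integral>\<^sup>+ x. ennreal (norm (f x - s i x)) + ennreal (norm (g x - t i x)) \<partial>M)"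
      proof (rule nn_integral_mono)
        fix x
        have "norm (f x - g x - (s i x - t i x)) \<le> norm (f x - s i x) + norm (g x - t i x)"
          by (metis diff_diff_eq2 diff_right_commute norm_triangle_ineq4 add_diff_eq diff_add_eq)
        then show "ennreal (norm (f x - g x - (s i x - t i x))) \<le>
            ennreal (norm (f x - s i x)) + ennreal (norm (g x - t i x))"
          by (metis ennreal_leI ennreal_plus norm_ge_zero)
      qed
      also have "\<dots> = (\<integral>\<^sup>+ x. ennreal (norm (f x - s i x)) \<partial>M) + (\<integral>\<^sup>+ x. ennreal (norm (g x - t i x)) \<partial>M)"
        by (rule nn_integral_add) measurable
      finally show "(\<integral>\<^sup>+ x. ennreal (norm (f x - g x - (s i x - t i x))) \<partial>M) \<le> \<dots>" .
    qed
    show "(\<lambda>i. (\<integral>\<^sup>+ x. ennreal (norm (f x - s i x)) \<partial>M) + (\<integral>\<^sup>+ x. ennreal (norm (g x - t i x)) \<partial>M))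
        \<longlonglongrightarrow> 0"
      using tendsto_add[OF lims limt] by simp
  qed simp
  moreover have "Bochner_Integration.simple_bochner_integrable M (\<lambda>x. s i x - t i x)" for i
    using simple_bochner_integrable_compose2[of "(-)" M "s i" "t i"] s t by simp
  moreover have "(\<lambda>i. Bochner_Integration.simple_bochner_integral M (\<lambda>x. s i x - t i x)) \<longlonglongrightarrow> I - J"
    unfolding simple_bochner_integral_diff[OF s t] by (intro tendsto_intros limI limJ)
  ultimately show ?thesis
    unfolding has_strong_bochner_integral_def by (intro conjI exI[of _ "\<lambda>i x. s i x - t i x"]) auto
qed

lemma has_strong_bochner_integral_blinfun:
  fixes L :: "'b::real_normed_vector \<Rightarrow>\<^sub>L 'c::real_normed_vector"
  assumes M: "complete_measure M" and f: "has_strong_bochner_integral M f I"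
  shows "has_strong_bochner_integral M (\<lambda>x. L (f x)) (L I)"
proof -
  obtain s where s: "\<And>i::nat. Bochner_Integration.simple_bochner_integrable M (s i)"
      and lims: "(\<lambda>i. \<integral>\<^sup>+ x. ennreal (norm (f x - s i x)) \<partial>M) \<longlonglongrightarrow> 0"
      and limI: "(\<lambda>i. Bochner_Integration.simple_bochner_integral M (s i)) \<longlonglongrightarrow> I"
      and smf: "strongly_measurable M f"
    using f unfolding has_strong_bochner_integral_def by blast
  have [measurable]: "(\<lambda>x. norm (f x - s i x)) \<in> borel_measurable M" for i
    using s[of i] smf by (auto intro!: strongly_measurable_norm_diff[OF M]
      elim: Bochner_Integration.simple_bochner_integrable.cases)
  have "strongly_measurable M (\<lambda>x. L (f x))"
  proof -
    obtain s' where s': "\<And>i::nat. simple_function M (s' i)"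
      and l: "AE x in M. (\<lambda>i. s' i x) \<longlonglongrightarrow> f x"
      using smf unfolding strongly_measurable_def by blast
    show ?thesis
      unfolding strongly_measurable_def
    proof (intro exI[of _ "\<lambda>i x. L (s' i x)"] conjI allI)
      show "simple_function M (\<lambda>x. L (s' i x))" for i
        by (rule simple_function_compose1[OF s'])
      show "AE x in M. (\<lambda>i. L (s' i x)) \<longlonglongrightarrow> L (f x)"
        using l by eventually_elim (intro tendsto_intros)
    qed
  qed
  moreover have "(\<lambda>i. \<integral>\<^sup>+ x. ennreal (norm (L (f x) - L (s i x))) \<partial>M) \<longlonglongrightarrow> 0"
  proof (rule tendsto_sandwich[OF _ _ tendsto_const])
    show "\<forall>\<^sub>F i in sequentially. (\<integral>\<^sup>+ x. ennreal (norm (L (f x) - L (s i x))) \<partial>M) \<le>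
        ennreal (norm L) * (\<integral>\<^sup>+ x. ennreal (norm (f x - s i x)) \<partial>M)"
    proof (intro always_eventually allI)
      fix i
      have "(\<integral>\<^sup>+ x. ennreal (norm (L (f x) - L (s i x))) \<partial>M) \<le>
        (\<integral>\<^sup>+ x. ennreal (norm L) * ennreal (norm (f x - s i x)) \<partial>M)"
        by (intro nn_integral_mono)
          (simp add: ennreal_leI norm_blinfun flip: blinfun.diff_right ennreal_mult)
      also have "\<dots> = ennreal (norm L) * (\<integral>\<^sup>+ x. ennreal (norm (f x - s i x)) \<partial>M)"
        by (rule nn_integral_cmult) measurable
      finally show "(\<integral>\<^sup>+ x. ennreal (norm (L (f x) - L (s i x))) \<partial>M) \<le> \<dots>" .
    qed
    show "(\<lambda>i. ennreal (norm L) * (\<integral>\<^sup>+ x. ennreal (norm (f x - s i x)) \<partial>M)) \<longlonglongrightarrow> 0"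
      using tendsto_mult_ennreal[OF tendsto_const lims, of "ennreal (norm L)"] by simp
  qed simp
  moreover have "Bochner_Integration.simple_bochner_integrable M (\<lambda>x. L (s i x))" for i
    using simple_bochner_integrable_compose2[of "\<lambda>x y. L x" M "s i" "s i"] s by (simp add: blinfun.zero_right)
  moreover have "(\<lambda>i. Bochner_Integration.simple_bochner_integral M (\<lambda>x. L (s i x))) \<longlonglongrightarrow> L I"
    unfolding simple_bochner_integral_linear[OF bounded_linear.linear[OF blinfun.bounded_linear_right] s]
    by (intro tendsto_intros limI)
  ultimately show ?thesis
    unfolding has_strong_bochner_integral_def by (intro conjI exI[of _ "\<lambda>i x. L (s i x)"]) auto
qed

text \<open>Mild solutions at different times involve integrals over different measure spaces
  \<open>lebesgue_on {0..t}\<close>. Extension by zero moves them all to \<open>lebesgue\<close>,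
  where they can be subtracted.\<close>

lemma has_strong_bochner_integral_restrict_space:
  assumes \<Omega>: "\<Omega> \<inter> space M \<in> sets M" and f: "has_strong_bochner_integral (restrict_space M \<Omega>) f I"
  shows "has_strong_bochner_integral M (\<lambda>x. indicator \<Omega> x *\<^sub>R f x) I"
proof -
  let ?R = "restrict_space M \<Omega>"
  obtain s where s: "\<And>i::nat. Bochner_Integration.simple_bochner_integrable ?R (s i)"
      and lims: "(\<lambda>i. \<integral>\<^sup>+ x. ennreal (norm (f x - s i x)) \<partial>?R) \<longlonglongrightarrow> 0"
      and limI: "(\<lambda>i. Bochner_Integration.simple_bochner_integral ?R (s i)) \<longlonglongrightarrow> I"
      and smf: "strongly_measurable ?R f"
    using f unfolding has_strong_bochner_integral_def by blast
  have "strongly_measurable M (\<lambda>x. indicator \<Omega> x *\<^sub>R f x)"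
  proof -
    obtain s' where s': "\<And>i::nat. simple_function ?R (s' i)"
      and l: "AE x in ?R. (\<lambda>i. s' i x) \<longlonglongrightarrow> f x"
      using smf unfolding strongly_measurable_def by blast
    show ?thesis
      unfolding strongly_measurable_def
    proof (intro exI[of _ "\<lambda>i x. indicator \<Omega> x *\<^sub>R s' i x"] conjI allI)
      show "simple_function M (\<lambda>x. indicator \<Omega> x *\<^sub>R s' i x)" for i
        using s'[of i] simple_function_restrict_space[OF \<Omega>] by blast
      show "AE x in M. (\<lambda>i. indicator \<Omega> x *\<^sub>R s' i x) \<longlonglongrightarrow> indicator \<Omega> x *\<^sub>R f x"
        using l unfolding AE_restrict_space_iff[OF \<Omega>]
        by eventually_elim (auto simp: indicator_def)
    qed
  qed
  moreover have "(\<integral>\<^sup>+ x. ennreal (norm (indicator \<Omega> x *\<^sub>R f x - indicator \<Omega> x *\<^sub>R s i x)) \<partial>M) =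
      (\<integral>\<^sup>+ x. ennreal (norm (f x - s i x)) \<partial>?R)" for i
    unfolding nn_integral_restrict_space[OF \<Omega>]
    by (intro nn_integral_cong) (auto simp: indicator_def)
  moreover have "Bochner_Integration.simple_bochner_integrable M (\<lambda>x. indicator \<Omega> x *\<^sub>R s i x)" for i
    using s[of i] simple_bochner_integrable_restrict_space[OF \<Omega>] by blast
  moreover have "Bochner_Integration.simple_bochner_integral M (\<lambda>x. indicator \<Omega> x *\<^sub>R s i x) =
      Bochner_Integration.simple_bochner_integral ?R (s i)" for i
    using simple_bochner_integral_restrict_space[OF \<Omega> s] by simp
  ultimately show ?thesis
    unfolding has_strong_bochner_integral_def using lims limI
    by (intro conjI exI[of _ "\<lambda>i x. indicator \<Omega> x *\<^sub>R s i x"]) auto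
qed

lemma has_strong_bochner_integral_indicator_const:
  assumes E: "E \<in> sets M" "emeasure M E < \<infinity>"
  shows "has_strong_bochner_integral M (\<lambda>x. indicator E x *\<^sub>R c) (measure M E *\<^sub>R c)"
proof -
  let ?s = "\<lambda>x. indicator E x *\<^sub>R c" and ?i = "indicator E :: 'a \<Rightarrow> real"
  have supp: "{y \<in> space M. ?i y \<noteq> 0} = E"
    using sets.sets_into_space[OF E(1)] by (auto simp: indicator_def)
  have sbi: "Bochner_Integration.simple_bochner_integrable M ?i"
    using supp E by (intro Bochner_Integration.simple_bochner_integrable.intros) auto
  have s: "Bochner_Integration.simple_bochner_integrable M ?s"
    using simple_bochner_integrable_compose2[of "\<lambda>x y. x *\<^sub>R c" M ?i ?i] sbi by simp
  \<comment> \<open>The integral is computed for the scalar indicator through its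
    \<open>nn_integral\<close>, then carried to the vector \<open>c\<close> by linearity of
    \<open>r \<mapsto> r *\<^sub>R c\<close>.\<close>
  have "Bochner_Integration.simple_bochner_integral M ?i = measure M E"
    using simple_bochner_integral_eq_nn_integral[OF sbi] E
    by (simp add: ennreal_indicator emeasure_eq_ennreal_measure)
  then have I: "Bochner_Integration.simple_bochner_integral M ?s = measure M E *\<^sub>R c"
    using simple_bochner_integral_linear[of "\<lambda>r. r *\<^sub>R c", OF _ sbi]
    by (simp add: linear_scaleR_left)
  have "strongly_measurable M ?s"
    unfolding strongly_measurable_def using s
    by (intro exI[of _ "\<lambda>_. ?s"]) (auto elim: Bochner_Integration.simple_bochner_integrable.cases)
  then show ?thesis
    unfolding has_strong_bochner_integral_def using s I
    by (intro conjI exI[of _ "\<lambda>_. ?s"]) (auto simp flip: zero_ennreal_def)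
qed

lemma complete_measure_lebesgue: "complete_measure lebesgue"
  by (rule completion.complete_measure_axioms)

text \<open>Meant for the integrands of a mild solution at the times \<open>t\<close> and
  \<open>t + k\<close>, with \<open>L = S k\<close>: by the semigroup law the two cancel on
  \<open>{0..t}\<close>. After subtracting \<open>c\<close> on the half-open rest, the integrand
  vanishes off \<open>{t<..t+k}\<close> and is at most \<epsilon> there, so the norm bound for a
  single integral suffices.\<close>

lemma strong_bochner_integral_increment_bound:
  fixes L :: "'b::real_normed_vector \<Rightarrow>\<^sub>L 'c::real_normed_vector"
  assumes t: "0 \<le> t" and k: "0 \<le> k"
    and F: "has_strong_bochner_integral (lebesgue_on {0..t}) F I"
    and G: "has_strong_bochner_integral (lebesgue_on {0..t+k}) G J"
    and eq: "\<And>s. s \<in> {0..t} \<Longrightarrow> G s = L (F s)"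
    and le: "\<And>s. s \<in> {t<..t+k} \<Longrightarrow> norm (G s - c) \<le> \<epsilon>"
    and \<epsilon>: "0 \<le> \<epsilon>"
  shows "norm (J - L I - k *\<^sub>R c) \<le> k * \<epsilon>"
proof -
  note M = complete_measure_lebesgue
  let ?E = "{t<..t+k}"
  have "has_strong_bochner_integral lebesgue (\<lambda>x. indicator ?E x *\<^sub>R c) (measure lebesgue ?E *\<^sub>R c)"
    using k by (intro has_strong_bochner_integral_indicator_const) (auto simp: emeasure_lborel_Ioc)
  then have E: "has_strong_bochner_integral lebesgue (\<lambda>x. indicator ?E x *\<^sub>R c) (k *\<^sub>R c)"
    using k by simp
  have "has_strong_bochner_integral lebesgue
      (\<lambda>x. indicator {0..t+k} x *\<^sub>R G x - L (indicator {0..t} x *\<^sub>R F x) - indicator ?E x *\<^sub>R c)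
      (J - L I - k *\<^sub>R c)"
    by (intro has_strong_bochner_integral_diff[OF M] has_strong_bochner_integral_blinfun[OF M]
        has_strong_bochner_integral_restrict_space E F G) auto
  then have "ennreal (norm (J - L I - k *\<^sub>R c)) \<le> (\<integral>\<^sup>+ x. ennreal \<epsilon> * indicator ?E x \<partial>lebesgue)"
  proof (rule has_strong_bochner_integral_norm_le[OF M])
    fix x :: real
    show "ennreal (norm (indicator {0..t+k} x *\<^sub>R G x - L (indicator {0..t} x *\<^sub>R F x)
        - indicator ?E x *\<^sub>R c)) \<le> ennreal \<epsilon> * indicator ?E x"
      using eq[of x] le[of x] t k
      by (auto simp: indicator_def blinfun.zero_right ennreal_leI)
  qed (intro borel_measurable_times_ennreal borel_measurable_const borel_measurable_indicator, simp)
  also have "\<dots> = ennreal (k * \<epsilon>)"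
    using k \<epsilon> by (simp add: nn_integral_cmult_indicator ennreal_mult mult.commute)
  finally show ?thesis
    using k \<epsilon> by (simp add: ennreal_le_iff)
qed

text \<open>Applied with \<open>t = 0\<close> to read off initial values, and with
  \<open>c = 0\<close> to remove the integral for zero input.\<close>

lemma strong_bochner_integral_bound:
  assumes t: "0 \<le> t" and F: "has_strong_bochner_integral (lebesgue_on {0..t}) F I"
    and le: "\<And>s. s \<in> {0..t} \<Longrightarrow> norm (F s) \<le> c" and c: "0 \<le> c"
  shows "norm I \<le> t * c"
proof -
  have "has_strong_bochner_integral lebesgue (\<lambda>x. indicator {0..t} x *\<^sub>R F x) I"
    by (rule has_strong_bochner_integral_restrict_space[OF _ F]) simp
  then have "ennreal (norm I) \<le> (\<integral>\<^sup>+ x. ennreal c * indicator {0..t} x \<partial>lebesgue)"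
  proof (rule has_strong_bochner_integral_norm_le[OF complete_measure_lebesgue])
    show "ennreal (norm (indicator {0..t} x *\<^sub>R F x)) \<le> ennreal c * indicator {0..t} x" for x
      using le[of x] by (auto simp: indicator_def ennreal_leI)
  qed (intro borel_measurable_times_ennreal borel_measurable_const borel_measurable_indicator, simp)
  also have "\<dots> = ennreal (t * c)"
    using t c by (simp add: nn_integral_cmult_indicator ennreal_mult mult.commute)
  finally show ?thesis
    using t c by (simp add: ennreal_le_iff)
qed

section \<open>Right increments and barriers\<close>

text \<open>Let \<open>c\<close> be the supremum of the times up to which \<open>y \<le> p\<close>
  holds throughout. Continuity gives \<open>y c \<le> p c\<close>. If the inequality is strict it
  persists to the right by continuity, and if it is an equality it persists by \<open>touch\<close>;
  so \<open>c < b\<close> is impossible.\<close>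

lemma continuous_barrier_le:
  fixes y p :: "real \<Rightarrow> real"
  assumes ab: "a \<le> b" and y: "continuous_on {a..b} y" and p: "continuous_on {a..b} p"
    and init: "y a \<le> p a"
    and touch: "\<And>s. \<lbrakk>a \<le> s; s < b; y s = p s\<rbrakk> \<Longrightarrow> \<forall>\<^sub>F k in at_right 0. y (s + k) \<le> p (s + k)"
  shows "y b \<le> p b"
proof -
  define A where "A = {s \<in> {a..b}. \<forall>r\<in>{a..s}. y r \<le> p r}"
  define c where "c = Sup A"
  have aA: "a \<in> A"
    using ab init by (auto simp: A_def)
  have bdd: "bdd_above A"
    by (rule bdd_aboveI[of _ b]) (auto simp: A_def)
  have c: "a \<le> c" "c \<le> b"
  proof -
    show "a \<le> c" unfolding c_def using aA bdd by (rule cSup_upper)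
    show "c \<le> b" unfolding c_def using aA by (intro cSup_least) (auto simp: A_def)
  qed
  have below: "y r \<le> p r" if r: "a \<le> r" "r < c" for r
  proof -
    obtain s where "s \<in> A" "r < s"
      using r(2) less_cSup_iff[of A r] aA bdd unfolding c_def by blast
    then show ?thesis
      using r(1) by (auto simp: A_def)
  qed
  have at_c: "y c \<le> p c"
  proof (cases "a < c")
    case True
    have "continuous_on {a..c} y" "continuous_on {a..c} p"
      using c by (auto intro: continuous_on_subset[OF y] continuous_on_subset[OF p])
    then have "(y \<longlongrightarrow> y c) (at_left c)" "(p \<longlongrightarrow> p c) (at_left c)"
      using True by (simp_all add: continuous_on_Icc_at_leftD)
    moreover have "\<forall>\<^sub>F r in at_left c. y r \<le> p r"
      unfolding eventually_at_left_field using True below by (intro exI[of _ a]) auto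
    ultimately show ?thesis
      by (intro tendsto_le[of "at_left c" p "p c" y "y c"]) auto
  next
    case False
    then show ?thesis using c init by simp
  qed
  have "c = b"
  proof (rule ccontr)
    assume "c \<noteq> b"
    then have cb: "c < b" using c by simp
    have "\<forall>\<^sub>F r in at_right c. y r \<le> p r"
    proof (cases "y c = p c")
      case True
      then show ?thesis
        using touch[OF c(1) cb] by (simp add: eventually_at_right_to_0[of _ c] add.commute)
    next
      case False
      have "continuous_on {c..b} y" "continuous_on {c..b} p"
        using c by (auto intro: continuous_on_subset[OF y] continuous_on_subset[OF p])
      then have "(y \<longlongrightarrow> y c) (at_right c)" "(p \<longlongrightarrow> p c) (at_right c)"
        using cb by (simp_all add: continuous_on_Icc_at_rightD)
      then have "((\<lambda>r. p r - y r) \<longlongrightarrow> p c - y c) (at_right c)"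
        by (intro tendsto_intros)
      moreover have "0 < p c - y c"
        using False at_c by simp
      ultimately have "\<forall>\<^sub>F r in at_right c. 0 < p r - y r"
        by (rule order_tendstoD(1))
      then show ?thesis by eventually_elim simp
    qed
    then obtain d where d: "c < d" "\<And>r. c < r \<Longrightarrow> r < d \<Longrightarrow> y r \<le> p r"
      unfolding eventually_at_right_field by blast
    obtain m where m: "c < m" "m < d" "m < b"
      using d(1) cb dense[of c "min d b"] by auto
    have "y r \<le> p r" if "a \<le> r" "r \<le> m" for r
      using that below[of r] at_c d(2)[of r] m by (cases r c rule: linorder_cases) auto
    then have "m \<in> A"
      using m c by (auto simp: A_def)
    then have "m \<le> c"
      unfolding c_def using bdd by (rule cSup_upper)
    then show False using m by simp
  qed
  then show ?thesis using at_c by simp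
qed

text \<open>A mean value inequality that asks for right increments only. The line with slope
  \<open>c + \<epsilon>\<close> starting at \<open>a\<close> is a barrier for the distance from
  \<open>e a\<close>, and \<epsilon> tends to 0 at the end.\<close>

lemma right_increment_bound:
  fixes e :: "real \<Rightarrow> 'a::real_normed_vector"
  assumes ab: "a \<le> b" and cont: "continuous_on {a..b} e"
    and inc: "\<And>s \<epsilon>. \<lbrakk>a \<le> s; s < b; 0 < \<epsilon>\<rbrakk> \<Longrightarrow>
      \<forall>\<^sub>F k in at_right 0. norm (e (s + k) - e s) \<le> (c + \<epsilon>) * k"
  shows "norm (e b - e a) \<le> c * (b - a)"
proof -
  have le: "norm (e b - e a) \<le> (c + \<epsilon>) * (b - a)" if \<epsilon>: "0 < \<epsilon>" for \<epsilon>
  proof (rule continuous_barrier_le[of a b "\<lambda>s. norm (e s - e a)" "\<lambda>s. (c + \<epsilon>) * (s - a)"])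
    fix s assume s: "a \<le> s" "s < b" "norm (e s - e a) = (c + \<epsilon>) * (s - a)"
    from inc[OF s(1,2) \<epsilon>]
    show "\<forall>\<^sub>F k in at_right 0. norm (e (s + k) - e a) \<le> (c + \<epsilon>) * (s + k - a)"
    proof eventually_elim
      case (elim k)
      have "norm (e (s + k) - e a) \<le> norm (e (s + k) - e s) + norm (e s - e a)"
        using norm_triangle_ineq[of "e (s + k) - e s" "e s - e a"] by simp
      then show ?case
        using elim s(3) by (simp add: algebra_simps)
    qed
  qed (use ab cont in \<open>auto intro!: continuous_intros\<close>)
  have "((\<lambda>\<epsilon>. (c + \<epsilon>) * (b - a)) \<longlongrightarrow> (c + 0) * (b - a)) (at_right 0)"
    by (intro tendsto_intros)
  moreover have "\<forall>\<^sub>F \<epsilon> in at_right 0. norm (e b - e a) \<le> (c + \<epsilon>) * (b - a)"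
    using le by (auto simp: eventually_at_right_field intro: exI[of _ 1])
  ultimately show ?thesis
    using tendsto_lowerbound[of "\<lambda>\<epsilon>. (c + \<epsilon>) * (b - a)" "(c + 0) * (b - a)" "at_right 0"] by simp
qed

section \<open>Strongly continuous semigroups and bounded perturbations\<close>

text \<open>The closed sets \<open>K N\<close> cover the space, so by Baire one of them contains a
  ball around some \<open>x0\<close> of radius \<open>r\<close>. A vector \<open>w\<close> of norm
  \<open>r\<close> is the difference of \<open>x0 + w\<close> and \<open>x0\<close>, both in
  \<open>K N\<close>, whence the bound \<open>2 * real N / r\<close>.\<close>

lemma banach_steinhaus:
  fixes F :: "nat \<Rightarrow> 'a::banach \<Rightarrow>\<^sub>L 'b::real_normed_vector"
  assumes bdd: "\<And>x. \<exists>B. \<forall>n. norm (F n x) \<le> B"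
  obtains B where "\<And>n. norm (F n) \<le> B"
proof -
  define K where "K N = {x. \<forall>n. norm (F n x) \<le> real N}" for N :: nat
  have cl: "closed (K N)" for N
  proof -
    have "K N = (\<Inter>n. {x. norm (F n x) \<le> real N})"
      by (auto simp: K_def)
    then show ?thesis
      by (auto intro!: closed_Collect_le continuous_intros)
  qed
  have UN: "\<Union>(range K) = UNIV"
  proof -
    have "x \<in> \<Union>(range K)" for x
    proof -
      obtain B where B: "\<forall>n. norm (F n x) \<le> B" using bdd by blast
      obtain N where "B \<le> real N" using real_arch_simple by blast
      then have "x \<in> K N" using B by (auto simp: K_def intro: order_trans)
      then show ?thesis by blast
    qed
    then show ?thesis by blast
  qed
  have "\<exists>N. interior (K N) \<noteq> {}"
  proof (rule ccontr)
    assume neg: "\<not> (\<exists>N. interior (K N) \<noteq> {})"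
    have "euclidean interior_of \<Union>(range K) = {}"
      using neg cl
      by (intro Baire_category_alt) (auto simp: completely_metrizable_space_euclidean)
    then show False using UN by simp
  qed
  then obtain N x0 where "x0 \<in> interior (K N)" by blast
  then obtain r where r: "0 < r" "cball x0 r \<subseteq> K N"
    using mem_interior_cball by blast
  have "norm (F n) \<le> 2 * real N / r" for n
  proof (rule norm_blinfun_bound)
    fix z :: 'a
    show "norm (F n z) \<le> 2 * real N / r * norm z"
    proof (cases "z = 0")
      case False
      define w where "w = (r / norm z) *\<^sub>R z"
      have "norm w = r" using False r by (simp add: w_def)
      then have "x0 + w \<in> K N" "x0 \<in> K N"
        using r by (auto simp: subset_eq dist_norm)
      then have "norm (F n (x0 + w)) \<le> real N" "norm (F n x0) \<le> real N"
        by (auto simp: K_def)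
      then have "norm (F n w) \<le> 2 * real N"
        using norm_triangle_ineq4[of "F n (x0 + w)" "F n x0"] by (simp add: blinfun.add_right)
      then show ?thesis
        using False r by (simp add: w_def blinfun.scaleR_right field_simps)
    qed (simp add: blinfun.zero_right)
  qed (use r in simp)
  then show thesis by (rule that)
qed

section \<open>Semigroup law, local boundedness and strong continuity\<close>

lemma c0_semigroup_add:
  "\<lbrakk>c0_semigroup T; 0 \<le> s; 0 \<le> t\<rbrakk> \<Longrightarrow> T (s + t) x = T s (T t x)"
  unfolding c0_semigroup_def by auto

lemma c0_semigroup_0: "c0_semigroup T \<Longrightarrow> T 0 x = x"
  unfolding c0_semigroup_def by auto

text \<open>Otherwise there are times \<open>\<tau> n\<close> tending to 0 along which the operator
  norms are unbounded. Strong continuity at 0 makes every orbit converge along these times, which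
  contradicts uniform boundedness.\<close>

lemma c0_semigroup_bounded_near_0:
  fixes T :: "real \<Rightarrow> 'x::banach \<Rightarrow>\<^sub>L 'x"
  assumes T: "c0_semigroup T"
  obtains M \<delta> where "1 \<le> M" "0 < \<delta>" "\<forall>t\<in>{0..\<delta>}. norm (T t) \<le> M"
proof -
  have "\<exists>M\<ge>1. \<exists>\<delta>>0. \<forall>t\<in>{0..\<delta>}. norm (T t) \<le> M"
  proof (rule ccontr)
    assume neg: "\<not> ?thesis"
    have "\<exists>t. 0 \<le> t \<and> t \<le> inverse (real (Suc n)) \<and> real (Suc n) < norm (T t)" for n
    proof (rule ccontr)
      assume "\<not> ?thesis"
      then have "\<forall>t\<in>{0..inverse (real (Suc n))}. norm (T t) \<le> real (Suc n)"
        by (auto simp: not_less)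
      moreover have "1 \<le> real (Suc n)" "0 < inverse (real (Suc n))" by simp_all
      ultimately show False using neg by blast
    qed
    then obtain \<tau> where \<tau>: "\<And>n. 0 \<le> \<tau> n" "\<And>n. \<tau> n \<le> inverse (real (Suc n))"
        "\<And>n. real (Suc n) < norm (T (\<tau> n))"
      by metis
    \<comment> \<open>The limit along \<open>at_right 0\<close> says nothing at time 0 itself. There
      the operator is the identity, of norm at most 1, so it cannot exceed
      \<open>real (Suc n)\<close>.\<close>
    have pos: "0 < \<tau> n" for n
    proof (rule ccontr)
      assume "\<not> 0 < \<tau> n"
      then have "\<tau> n = 0" using \<tau>(1)[of n] by simp
      then have "norm (T (\<tau> n)) \<le> 1"
        using T norm_blinfun_id_le by (simp add: c0_semigroup_def)
      moreover have "1 \<le> real (Suc n)" by simp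
      ultimately show False using \<tau>(3)[of n] by linarith
    qed
    have "\<tau> \<longlonglongrightarrow> 0"
      by (rule tendsto_sandwich[OF _ _ tendsto_const LIMSEQ_inverse_real_of_nat])
        (intro always_eventually allI \<tau>)+
    then have lim: "filterlim \<tau> (at_right 0) sequentially"
      unfolding filterlim_at using pos by (intro conjI always_eventually) (auto simp: less_le)
    have "\<exists>B. \<forall>n. norm (T (\<tau> n) x) \<le> B" for x
    proof -
      have "((\<lambda>t. T t x) \<longlongrightarrow> x) (at_right 0)"
        using T by (simp add: c0_semigroup_def)
      then have "(\<lambda>n. T (\<tau> n) x) \<longlonglongrightarrow> x"
        using lim by (rule filterlim_compose)
      then have "bounded (range (\<lambda>n. T (\<tau> n) x))"
        by (rule convergent_imp_bounded)
      then show ?thesis by (auto simp: bounded_iff)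
    qed
    then obtain B where B: "\<And>n. norm (T (\<tau> n)) \<le> B"
      using banach_steinhaus[of "\<lambda>n. T (\<tau> n)"] by blast
    obtain N where "B \<le> real N" using real_arch_simple by blast
    then show False using B[of N] \<tau>(3)[of N] by simp
  qed
  then show thesis using that by blast
qed

lemma c0_semigroup_near_id:
  assumes T: "c0_semigroup T" and "0 < \<epsilon>"
  obtains d where "0 < d" "\<And>h. 0 \<le> h \<Longrightarrow> h < d \<Longrightarrow> norm (T h x - x) < \<epsilon>"
proof -
  have "((\<lambda>t. T t x) \<longlongrightarrow> x) (at_right 0)"
    using T by (simp add: c0_semigroup_def)
  then have "\<forall>\<^sub>F h in at_right 0. norm (T h x - x) < \<epsilon>"
    using assms(2) by (auto simp: tendsto_iff dist_norm)
  then obtain d where d: "0 < d" "\<And>h. 0 < h \<Longrightarrow> h < d \<Longrightarrow> norm (T h x - x) < \<epsilon>"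
    unfolding eventually_at_right_field by auto
  have "norm (T h x - x) < \<epsilon>" if "0 \<le> h" "h < d" for h
    using that d assms by (cases "h = 0") (auto simp: c0_semigroup_0)
  then show thesis using d(1) that by blast
qed

text \<open>Factoring out the operator at the earlier of two times leaves \<open>T h x - x\<close>
  with \<open>h\<close> the distance between them. The uniform bound \<open>M\<close> therefore
  turns right continuity at 0 into continuity from both sides.\<close>

lemma c0_semigroup_continuous_on:
  assumes T: "c0_semigroup T" and M: "\<forall>t\<in>{0..\<delta>}. norm (T t) \<le> M"
  shows "continuous_on {0..\<delta>} (\<lambda>t. T t x)"
proof (cases "0 \<le> \<delta>")
  case True
  have M0: "0 \<le> M" using M True norm_ge_zero[of "T 0"] by (meson atLeastAtMost_iff order_refl order_trans)
  have inc: "norm (T t x - T s x) \<le> M * norm (T (t - s) x - x)" if "0 \<le> s" "s \<le> t" "t \<le> \<delta>" for s t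
  proof -
    have "T t x = T s (T (t - s) x)"
      using c0_semigroup_add[OF T, of s "t - s" x] that by simp
    then have "norm (T t x - T s x) = norm (T s (T (t - s) x - x))"
      by (simp add: blinfun.diff_right)
    also have "\<dots> \<le> norm (T s) * norm (T (t - s) x - x)"
      by (rule norm_blinfun)
    also have "\<dots> \<le> M * norm (T (t - s) x - x)"
      using M that by (intro mult_right_mono) auto
    finally show ?thesis .
  qed
  show ?thesis
  proof (rule continuous_onI)
    fix s \<epsilon> :: real assume s: "s \<in> {0..\<delta>}" and \<epsilon>: "0 < \<epsilon>"
    obtain d where d: "0 < d" "\<And>h. 0 \<le> h \<Longrightarrow> h < d \<Longrightarrow> norm (T h x - x) < \<epsilon> / (M + 1)"
      using c0_semigroup_near_id[OF T, of "\<epsilon> / (M + 1)" x] \<epsilon> M0 by auto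
    have small: "M * norm (T h x - x) \<le> \<epsilon>" if "0 \<le> h" "h < d" for h
    proof -
      have "M * norm (T h x - x) \<le> (M + 1) * norm (T h x - x)"
        by (intro mult_right_mono) auto
      also have "\<dots> \<le> \<epsilon>"
        using d(2)[OF that] M0 by (simp add: field_simps)
      finally show ?thesis .
    qed
    have "dist (T t x) (T s x) \<le> \<epsilon>" if t: "t \<in> {0..\<delta>}" "dist t s < d" for t
    proof (cases "s \<le> t")
      case True
      then have "dist (T t x) (T s x) \<le> M * norm (T (t - s) x - x)"
        using inc[of s t] s t by (simp add: dist_norm)
      also have "\<dots> \<le> \<epsilon>" using True t by (intro small) (auto simp: dist_real_def)
      finally show ?thesis .
    next
      case False
      then have "dist (T t x) (T s x) \<le> M * norm (T (s - t) x - x)"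
        using inc[of t s] s t by (simp add: dist_norm norm_minus_commute)
      also have "\<dots> \<le> \<epsilon>" using False t by (intro small) (auto simp: dist_real_def)
      finally show ?thesis .
    qed
    then show "\<exists>d>0. \<forall>t\<in>{0..\<delta>}. dist t s < d \<longrightarrow> dist (T t x) (T s x) \<le> \<epsilon>"
      using d(1) by blast
  qed
qed simp

section \<open>Generators, their domains and bounded perturbations\<close>

lemma generatesD:
  assumes "generates D A T"
  shows "c0_semigroup T"
    and "x \<in> D \<longleftrightarrow> (\<exists>y. ((\<lambda>h. (T h x - x) /\<^sub>R h) \<longlongrightarrow> y) (at_right 0))"
    and "x \<in> D \<Longrightarrow> ((\<lambda>h. (T h x - x) /\<^sub>R h) \<longlongrightarrow> A x) (at_right 0)"
  using assms unfolding generates_def by blast+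

text \<open>\<open>T t\<close> commutes with \<open>T h\<close>, hence with the difference
  quotients, and as a bounded operator it preserves their limit.\<close>

lemma generator_domain_invariant:
  assumes T: "generates D A T" and x: "x \<in> D" and t: "0 \<le> t"
  shows "T t x \<in> D"
proof -
  have "((\<lambda>h. T t ((T h x - x) /\<^sub>R h)) \<longlongrightarrow> T t (A x)) (at_right 0)"
    by (intro tendsto_intros generatesD(3)[OF T x])
  moreover have "\<forall>\<^sub>F h in at_right 0. T t ((T h x - x) /\<^sub>R h) = (T h (T t x) - T t x) /\<^sub>R h"
    using eventually_at_right_less[of "0::real"]
  proof eventually_elim
    case (elim h)
    then have "T t (T h x) = T h (T t x)"
      using c0_semigroup_add[OF generatesD(1)[OF T]] t by (metis add.commute less_imp_le)
    then show ?case by (simp add: blinfun.scaleR_right blinfun.diff_right)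
  qed
  ultimately have "((\<lambda>h. (T h (T t x) - T t x) /\<^sub>R h) \<longlongrightarrow> T t (A x)) (at_right 0)"
    by (rule Lim_transform_eventually)
  then show ?thesis using generatesD(2)[OF T] by blast
qed

text \<open>The fundamental theorem of calculus, brought into the shape of the one-sided quotients
  that define a generator.\<close>

lemma integral_right_quotient_tendsto:
  fixes f :: "real \<Rightarrow> 'a::banach"
  assumes f: "continuous_on {a..b} f" and t: "a \<le> t" "t < b"
  shows "((\<lambda>k. (integral {a..t + k} f - integral {a..t} f) /\<^sub>R k) \<longlongrightarrow> f t) (at_right 0)"
proof -
  let ?F = "\<lambda>u. integral {a..u} f"
  have "(?F has_vector_derivative f t) (at t within {t..b})"
    using integral_has_vector_derivative[OF f, of t] t
    by (auto intro: has_vector_derivative_within_subset)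
  then have "((\<lambda>y. (1 / norm (y - t)) *\<^sub>R (?F y - (?F t + (y - t) *\<^sub>R f t))) \<longlongrightarrow> 0) (at_right t)"
    using t by (simp add: has_vector_derivative_def has_derivative_within at_within_Icc_at_right)
  then have "((\<lambda>k. (1 / norm (k + t - t)) *\<^sub>R (?F (k + t) - (?F t + (k + t - t) *\<^sub>R f t))) \<longlongrightarrow> 0)
      (at_right 0)"
    by (subst (asm) filterlim_at_right_to_0)
  then have "((\<lambda>k. (?F (t + k) - ?F t) /\<^sub>R k - f t) \<longlongrightarrow> 0) (at_right 0)"
  proof (rule Lim_transform_eventually)
    show "\<forall>\<^sub>F k in at_right 0. (1 / norm (k + t - t)) *\<^sub>R (?F (k + t) - (?F t + (k + t - t) *\<^sub>R f t))
        = (?F (t + k) - ?F t) /\<^sub>R k - f t"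
      using eventually_at_right_less[of "0::real"]
      by eventually_elim (simp add: add.commute algebra_simps divide_inverse)
  qed
  then show ?thesis by (simp add: LIM_zero_iff)
qed

text \<open>The averages \<open>F h /\<^sub>R h\<close> of the orbit of \<open>x\<close> converge to
  \<open>x\<close> as \<open>h\<close> decreases to 0. They lie in \<open>D\<close> because the
  generator quotient at \<open>F h\<close> is the right quotient of \<open>F\<close> at
  \<open>h\<close> minus the one at 0, and this tends to \<open>T h x - x\<close>.\<close>

lemma generator_domain_dense:
  fixes T :: "real \<Rightarrow> 'x::banach \<Rightarrow>\<^sub>L 'x"
  assumes T: "generates D A T"
  shows "closure D = UNIV"
proof -
  note C0 = generatesD(1)[OF T]
  obtain M \<delta> where \<delta>: "0 < \<delta>" and M: "\<forall>t\<in>{0..\<delta>}. norm (T t) \<le> M"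
    by (rule c0_semigroup_bounded_near_0[OF C0])
  have "x \<in> closure D" for x
  proof -
    let ?f = "\<lambda>s. T s x"
    define F where "F u = integral {0..u} ?f" for u
    have cont: "continuous_on {0..\<delta>} ?f"
      by (rule c0_semigroup_continuous_on[OF C0 M])
    have quot: "((\<lambda>k. (F (t + k) - F t) /\<^sub>R k) \<longlongrightarrow> T t x) (at_right 0)" if "0 \<le> t" "t < \<delta>" for t
      unfolding F_def using integral_right_quotient_tendsto[OF cont that] .
    \<comment> \<open>\<open>T k\<close> shifts the integral over \<open>{0..h}\<close> to one over
      \<open>{k..h + k}\<close>, which is \<open>F (h + k) - F k\<close>. The condition
      \<open>h + k \<le> \<delta>\<close> keeps all integrals where the orbit is known to be
      continuous.\<close>
    have TF: "T k (F h) - F h = (F (h + k) - F h) - F k" if "0 \<le> k" "0 \<le> h" "h + k \<le> \<delta>" for h k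
    proof -
      have int: "?f integrable_on {a..b}" if "0 \<le> a" "b \<le> \<delta>" for a b
        using that by (intro integrable_continuous_real continuous_on_subset[OF cont]) auto
      have "T k (F h) = integral {0..h} (T k \<circ> ?f)"
        unfolding F_def using that
        by (intro integral_linear[symmetric] int blinfun.bounded_linear_right) auto
      also have "\<dots> = integral {0..h} (?f \<circ> (+) k)"
        using that by (intro integral_cong) (simp add: c0_semigroup_add[OF C0])
      also have "\<dots> = integral {k..h + k} ?f"
        by (simp add: integral_shift_Icc_real)
      finally have "T k (F h) = integral {k..h + k} ?f" .
      moreover have "F k + integral {k..h + k} ?f = F (h + k)"
        unfolding F_def using that by (intro Henstock_Kurzweil_Integration.integral_combine int) auto
      ultimately show ?thesis by (simp add: algebra_simps)
    qed
    have inD: "F h /\<^sub>R h \<in> D" if h: "0 < h" "h < \<delta>" for h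
    proof -
      have "((\<lambda>k. ((F (h + k) - F h) /\<^sub>R k - (F (0 + k) - F 0) /\<^sub>R k) /\<^sub>R h)
          \<longlongrightarrow> (T h x - T 0 x) /\<^sub>R h) (at_right 0)"
        using h by (intro tendsto_intros quot) auto
      moreover have "\<forall>\<^sub>F k in at_right 0. ((F (h + k) - F h) /\<^sub>R k - (F (0 + k) - F 0) /\<^sub>R k) /\<^sub>R h
          = (T k (F h /\<^sub>R h) - F h /\<^sub>R h) /\<^sub>R k"
      proof -
        have "\<forall>\<^sub>F k in at_right 0. k \<in> {0<..<\<delta> - h}"
          using h by (intro eventually_at_right_real) simp
        then show ?thesis
        proof eventually_elim
          case (elim k)
          have F0: "F 0 = 0" by (simp add: F_def)
          have "(T k (F h /\<^sub>R h) - F h /\<^sub>R h) /\<^sub>R k = ((T k (F h) - F h) /\<^sub>R k) /\<^sub>R h"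
            by (simp add: blinfun.scaleR_right algebra_simps)
          also have "T k (F h) - F h = (F (h + k) - F h) - F k"
            using elim h by (intro TF) auto
          finally show ?case
            using F0 by (simp add: scaleR_diff_right)
        qed
      qed
      ultimately have "((\<lambda>k. (T k (F h /\<^sub>R h) - F h /\<^sub>R h) /\<^sub>R k) \<longlongrightarrow> (T h x - T 0 x) /\<^sub>R h) (at_right 0)"
        by (rule Lim_transform_eventually)
      then show ?thesis using generatesD(2)[OF T] by blast
    qed
    have "((\<lambda>k. F k /\<^sub>R k) \<longlongrightarrow> x) (at_right 0)"
      using quot[of 0] \<delta> by (simp add: F_def c0_semigroup_0[OF C0])
    moreover have "\<forall>\<^sub>F k in at_right 0. F k /\<^sub>R k \<in> closure D"
    proof -
      have "\<forall>\<^sub>F k in at_right 0. k \<in> {0<..<\<delta>}"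
        using \<delta> by (intro eventually_at_right_real) simp
      then show ?thesis
        by eventually_elim (use inD closure_subset in auto)
    qed
    ultimately show ?thesis
      by (intro Lim_in_closed_set[of "closure D"]) auto
  qed
  then show ?thesis by blast
qed

text \<open>Strong continuity together with a uniform bound replaces continuity in operator norm:
  \<open>F s (g s)\<close> is split into \<open>F s (g s - g a)\<close>, controlled by the bound,
  and \<open>F s (g a)\<close>, controlled by strong continuity.\<close>

lemma continuous_on_blinfun_apply_strong:
  fixes F :: "real \<Rightarrow> 'a::real_normed_vector \<Rightarrow>\<^sub>L 'b::real_normed_vector"
  assumes M: "\<forall>s\<in>A. norm (F s) \<le> M" and F: "\<And>x. continuous_on A (\<lambda>s. F s x)"
    and g: "continuous_on A g"
  shows "continuous_on A (\<lambda>s. F s (g s))"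
  unfolding continuous_on_def
proof
  fix a assume a: "a \<in> A"
  have "((\<lambda>s. F s (g s - g a)) \<longlongrightarrow> 0) (at a within A)"
  proof (rule Lim_null_comparison)
    show "\<forall>\<^sub>F s in at a within A. norm (F s (g s - g a)) \<le> M * norm (g s - g a)"
      unfolding eventually_at_filter using M
      by (intro always_eventually allI impI)
        (meson mult_right_mono norm_blinfun norm_ge_zero order_trans)
    have "((\<lambda>s. g s - g a) \<longlongrightarrow> 0) (at a within A)"
      using g a by (simp add: continuous_on_def LIM_zero)
    then show "((\<lambda>s. M * norm (g s - g a)) \<longlongrightarrow> 0) (at a within A)"
      using tendsto_mult_right_zero tendsto_norm_zero by blast
  qed
  moreover have "((\<lambda>s. F s (g a)) \<longlongrightarrow> F a (g a)) (at a within A)"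
    using F a by (simp add: continuous_on_def)
  ultimately have "((\<lambda>s. F s (g s - g a) + F s (g a)) \<longlongrightarrow> 0 + F a (g a)) (at a within A)"
    by (rule tendsto_add)
  then show "((\<lambda>s. F s (g s)) \<longlongrightarrow> F a (g a)) (at a within A)"
    by (simp add: blinfun.diff_right)
qed

text \<open>The curve \<open>e s = S (k - s) (T s y)\<close> runs from \<open>S k y\<close> to
  \<open>T k y\<close>. Its formal derivative is \<open>S (k - s) (B (T s y))\<close>, as the
  contributions of \<open>A\<close> cancel; the stated constant bounds it, and
  \<open>right_increment_bound\<close> integrates the bound. Invariance of the domain makes both
  generator limits available at \<open>T s y\<close>.\<close>

lemma perturbed_semigroup_domain_bound:
  fixes S T :: "real \<Rightarrow> 'x::banach \<Rightarrow>\<^sub>L 'x"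
  assumes S: "generates D A S" and T: "generates D (\<lambda>x. A x + blinfun_apply B x) T"
    and M: "\<forall>t\<in>{0..\<delta>}. norm (S t) \<le> M" "\<forall>t\<in>{0..\<delta>}. norm (T t) \<le> M"
    and k: "0 \<le> k" "k \<le> \<delta>" and y: "y \<in> D"
  shows "norm (T k y - S k y) \<le> M * (norm B * (M * norm y)) * k"
proof -
  note CS = generatesD(1)[OF S] and CT = generatesD(1)[OF T]
  let ?c = "M * (norm B * (M * norm y))"
  define e where "e s = S (k - s) (T s y)" for s
  have M0: "0 \<le> M"
    using M(1) k norm_ge_zero[of "S 0"] by (meson atLeastAtMost_iff order_refl order_trans)
  have cont: "continuous_on {0..k} e"
    unfolding e_def
  proof (rule continuous_on_blinfun_apply_strong[where M = M])
    show "continuous_on {0..k} (\<lambda>s. S (k - s) x)" for x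
      using k by (intro continuous_on_compose2[OF c0_semigroup_continuous_on[OF CS M(1)]] continuous_intros) auto
    show "continuous_on {0..k} (\<lambda>s. T s y)"
      using k by (intro continuous_on_subset[OF c0_semigroup_continuous_on[OF CT M(2)]]) auto
  qed (use M k in auto)
  have "norm (e k - e 0) \<le> ?c * (k - 0)"
  proof (rule right_increment_bound[OF k(1) cont])
    fix s \<epsilon> :: real assume s: "0 \<le> s" "s < k" and \<epsilon>: "0 < \<epsilon>"
    define z where "z = T s y"
    have z: "z \<in> D" unfolding z_def using generator_domain_invariant[OF T y s(1)] .
    have "norm z \<le> norm (T s) * norm y"
      unfolding z_def by (rule norm_blinfun)
    also have "\<dots> \<le> M * norm y"
      using M(2) s k by (intro mult_right_mono) auto
    finally have nz: "norm z \<le> M * norm y" .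
    have "norm (B z) \<le> norm B * norm z" by (rule norm_blinfun)
    also have "\<dots> \<le> norm B * (M * norm y)" by (intro mult_left_mono nz) simp
    finally have nB: "norm (B z) \<le> norm B * (M * norm y)" .
    \<comment> \<open>The increment carries one more factor \<open>M\<close>, so \<eta> must satisfy
      \<open>M * \<eta> \<le> \<epsilon>\<close>; adding 1 keeps the denominator positive.\<close>
    define \<eta> where "\<eta> = \<epsilon> / (M + 1)"
    have \<eta>: "0 < \<eta>" "M * \<eta> \<le> \<epsilon>"
      using \<epsilon> M0 by (auto simp: \<eta>_def field_simps)
    have "((\<lambda>j. (T j z - z) /\<^sub>R j - (S j z - z) /\<^sub>R j) \<longlongrightarrow> (A z + B z) - A z) (at_right 0)"
      by (intro tendsto_diff generatesD(3)[OF T z] generatesD(3)[OF S z])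
    then have "((\<lambda>j. (T j z - S j z) /\<^sub>R j) \<longlongrightarrow> B z) (at_right 0)"
      by (simp flip: scaleR_diff_right)
    then have "\<forall>\<^sub>F j in at_right 0. norm ((T j z - S j z) /\<^sub>R j - B z) < \<eta>"
      using \<eta> by (auto simp: tendsto_iff dist_norm)
    moreover have "\<forall>\<^sub>F j in at_right 0. j \<in> {0<..<k - s}"
      using s by (intro eventually_at_right_real) simp
    ultimately show "\<forall>\<^sub>F j in at_right 0. norm (e (s + j) - e s) \<le> (?c + \<epsilon>) * j"
    proof eventually_elim
      case (elim j)
      have "norm ((T j z - S j z) /\<^sub>R j) \<le> norm (B z) + \<eta>"
        using elim(1) norm_triangle_sub[of "(T j z - S j z) /\<^sub>R j" "B z"] by linarith
      also have "\<dots> \<le> norm B * (M * norm y) + \<eta>"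
        using nB by simp
      finally have "norm (T j z - S j z) / j \<le> norm B * (M * norm y) + \<eta>"
        using elim(2) by (simp add: divide_inverse mult.commute)
      then have d: "norm (T j z - S j z) \<le> j * (norm B * (M * norm y) + \<eta>)"
        using elim(2) by (simp add: pos_divide_le_eq mult.commute)
      \<comment> \<open>Both values of \<open>e\<close> share the factor
        \<open>S (k - s - j)\<close>, so their difference is this operator applied to
        \<open>T j z - S j z\<close>.\<close>
      have "e (s + j) = S (k - s - j) (T j z)"
        using c0_semigroup_add[OF CT, of j s y] elim(2) s by (simp add: e_def z_def add.commute diff_diff_eq)
      moreover have "e s = S (k - s - j) (S j z)"
        using c0_semigroup_add[OF CS, of "k - s - j" j z] elim(2) s by (simp add: e_def z_def)
      ultimately have "norm (e (s + j) - e s) = norm (S (k - s - j) (T j z - S j z))"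
        by (simp add: blinfun.diff_right)
      also have "\<dots> \<le> norm (S (k - s - j)) * norm (T j z - S j z)"
        by (rule norm_blinfun)
      also have "\<dots> \<le> M * (j * (norm B * (M * norm y) + \<eta>))"
        using M(1) elim(2) s k d M0 by (intro mult_mono) auto
      also have "\<dots> = (?c + M * \<eta>) * j"
        by (simp add: algebra_simps)
      also have "\<dots> \<le> (?c + \<epsilon>) * j"
        using \<eta> elim(2) by (intro mult_right_mono) auto
      finally show ?case .
    qed
  qed
  then show ?thesis
    using c0_semigroup_0[OF CS] c0_semigroup_0[OF CT] by (simp add: e_def)
qed

text \<open>The Lipschitz bound on the domain extends by density, so the difference quotients are equibounded
  and converge on all of the space, not only on the domain.\<close>

lemma perturbed_semigroup_quotient_tendsto:
  fixes S T :: "real \<Rightarrow> 'x::banach \<Rightarrow>\<^sub>L 'x"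
  assumes S: "generates D A S" and T: "generates D (\<lambda>x. A x + blinfun_apply B x) T"
  shows "((\<lambda>k. (T k y - S k y) /\<^sub>R k) \<longlongrightarrow> B y) (at_right 0)"
proof -
  note CS = generatesD(1)[OF S] and CT = generatesD(1)[OF T]
  obtain M1 \<delta>1 where 1: "1 \<le> M1" "0 < \<delta>1" "\<forall>t\<in>{0..\<delta>1}. norm (S t) \<le> M1"
    by (rule c0_semigroup_bounded_near_0[OF CS])
  obtain M2 \<delta>2 where 2: "1 \<le> M2" "0 < \<delta>2" "\<forall>t\<in>{0..\<delta>2}. norm (T t) \<le> M2"
    by (rule c0_semigroup_bounded_near_0[OF CT])
  define M where "M = max M1 M2"
  define \<delta> where "\<delta> = min \<delta>1 \<delta>2"
  have \<delta>: "0 < \<delta>" using 1 2 by (simp add: \<delta>_def)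
  have M: "\<forall>t\<in>{0..\<delta>}. norm (S t) \<le> M" "\<forall>t\<in>{0..\<delta>}. norm (T t) \<le> M"
    using 1(3) 2(3) by (auto simp: \<delta>_def M_def intro: max.coboundedI1 max.coboundedI2)
  define K where "K = M * norm B * M"
  have K0: "0 \<le> K" using 1(1) by (simp add: K_def M_def)
  have bound: "norm (T k x - S k x) \<le> K * norm x * k" if k: "0 \<le> k" "k \<le> \<delta>" for k x
  proof -
    have "D \<subseteq> {x. norm (T k x - S k x) \<le> K * norm x * k}"
      using perturbed_semigroup_domain_bound[OF S T M k] by (auto simp: K_def mult.assoc)
    moreover have "closed {x. norm (T k x - S k x) \<le> K * norm x * k}"
      by (intro closed_Collect_le continuous_intros)
    ultimately have "closure D \<subseteq> {x. norm (T k x - S k x) \<le> K * norm x * k}"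
      by (rule closure_minimal)
    then show ?thesis using generator_domain_dense[OF S] by auto
  qed
  show ?thesis
  proof (rule tendstoI)
    fix \<epsilon> :: real assume \<epsilon>: "0 < \<epsilon>"
    \<comment> \<open>Replacing \<open>y\<close> by a nearby \<open>z\<close> in the domain costs
      \<open>K * \<eta>\<close> in the quotient and \<open>norm B * \<eta>\<close> in the limit,
      together less than half of \<epsilon>. The other half is left for convergence at
      \<open>z\<close>.\<close>
    define \<eta> where "\<eta> = \<epsilon> / (2 * (K + norm B + 1))"
    have KB: "0 < K + norm B + 1" using K0 by (simp add: add_nonneg_pos)
    then have \<eta>: "0 < \<eta>" "(K + norm B) * \<eta> < \<epsilon> / 2"
      using \<epsilon> by (auto simp: \<eta>_def field_simps)
    have "y \<in> closure D" using generator_domain_dense[OF S] by simp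
    then obtain z where z: "z \<in> D" "dist z y < \<eta>"
      using \<eta>(1) unfolding closure_approachable by blast
    have "((\<lambda>j. (T j z - z) /\<^sub>R j - (S j z - z) /\<^sub>R j) \<longlongrightarrow> (A z + B z) - A z) (at_right 0)"
      by (intro tendsto_diff generatesD(3)[OF T z(1)] generatesD(3)[OF S z(1)])
    then have "((\<lambda>j. (T j z - S j z) /\<^sub>R j) \<longlongrightarrow> B z) (at_right 0)"
      by (simp flip: scaleR_diff_right)
    then have "\<forall>\<^sub>F k in at_right 0. norm ((T k z - S k z) /\<^sub>R k - B z) < \<epsilon> / 2"
      using \<epsilon> half_gt_zero unfolding tendsto_iff dist_norm by blast
    moreover have "\<forall>\<^sub>F k in at_right 0. k \<in> {0<..<\<delta>}"
      using \<delta> by (intro eventually_at_right_real)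
    ultimately show "\<forall>\<^sub>F k in at_right 0. dist ((T k y - S k y) /\<^sub>R k) (B y) < \<epsilon>"
    proof eventually_elim
      case (elim k)
      have zy: "norm (y - z) \<le> \<eta>" using z(2) by (simp add: dist_norm norm_minus_commute)
      have "norm (T k (y - z) - S k (y - z)) \<le> K * norm (y - z) * k"
        using elim(2) by (intro bound) auto
      also have "\<dots> \<le> K * \<eta> * k"
        using elim(2) K0 zy by (intro mult_right_mono mult_left_mono) auto
      finally have "norm (T k (y - z) - S k (y - z)) / k \<le> K * \<eta>"
        using elim(2) by (simp add: pos_divide_le_eq)
      then have a: "norm ((T k (y - z) - S k (y - z)) /\<^sub>R k) \<le> K * \<eta>"
        using elim(2) by (simp add: divide_inverse mult.commute)
      have "norm (B (y - z)) \<le> norm B * norm (y - z)" by (rule norm_blinfun)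
      also have "\<dots> \<le> norm B * \<eta>" using zy by (intro mult_left_mono) auto
      finally have b: "norm (B (y - z)) \<le> norm B * \<eta>" .
      have "(T k y - S k y) /\<^sub>R k - B y = (T k (y - z) - S k (y - z)) /\<^sub>R k
          + ((T k z - S k z) /\<^sub>R k - B z) - B (y - z)"
        by (simp add: blinfun.diff_right scaleR_diff_right)
      also have "norm \<dots> \<le> norm ((T k (y - z) - S k (y - z)) /\<^sub>R k)
          + norm ((T k z - S k z) /\<^sub>R k - B z) + norm (B (y - z))"
        by (intro order_trans[OF norm_triangle_ineq4] add_right_mono norm_triangle_ineq)
      also have "\<dots> < \<epsilon>"
        using a b elim(1) \<eta>(2) by (simp add: algebra_simps)
      finally show ?case by (simp add: dist_norm)
    qed
  qed
qed

section \<open>Exponential stability\<close>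

text \<open>At some \<open>t0 > 0\<close> the norm is at most 1/2, and by the semigroup law each
  further period \<open>t0\<close> halves the bound. A general time is a whole number of periods
  plus a remainder, on which \<open>M0\<close> is used.\<close>

lemma c0_semigroup_exponentially_stable:
  fixes T :: "real \<Rightarrow> 'x::real_normed_vector \<Rightarrow>\<^sub>L 'x"
  assumes T: "c0_semigroup T" and bdd: "\<And>t. 0 \<le> t \<Longrightarrow> norm (T t) \<le> M0"
    and lim: "((\<lambda>t. norm (T t)) \<longlongrightarrow> 0) at_top"
  obtains M \<omega> where "1 \<le> M" "0 < \<omega>" "\<And>t. 0 \<le> t \<Longrightarrow> norm (T t) \<le> M * exp (- \<omega> * t)"
proof -
  have "\<forall>\<^sub>F t in at_top. norm (T t) < 1 / 2"
    using lim by (rule order_tendstoD(2)) simp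
  then obtain t1 where t1: "\<And>t. t1 \<le> t \<Longrightarrow> norm (T t) < 1 / 2"
    unfolding eventually_at_top_linorder by blast
  define t0 where "t0 = max t1 1"
  have t0: "0 < t0" "norm (T t0) \<le> 1 / 2"
    using t1[of t0] by (auto simp: t0_def)
  have M0: "0 \<le> M0" using bdd[of 0] norm_ge_zero order_trans by blast
  have pow: "norm (T (real n * t0 + r)) \<le> (1 / 2) ^ n * M0" if r: "0 \<le> r" for n r
  proof (induction n)
    case 0
    then show ?case using bdd[OF r] by simp
  next
    case (Suc n)
    have "T (t0 + (real n * t0 + r)) = T t0 o\<^sub>L T (real n * t0 + r)"
      using T t0 r unfolding c0_semigroup_def by simp
    then have "norm (T (real (Suc n) * t0 + r)) = norm (T t0 o\<^sub>L T (real n * t0 + r))"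
      by (simp add: algebra_simps)
    also have "\<dots> \<le> norm (T t0) * norm (T (real n * t0 + r))"
      by (rule norm_blinfun_compose)
    also have "\<dots> \<le> (1 / 2) * ((1 / 2) ^ n * M0)"
      using Suc t0 by (intro mult_mono) auto
    finally show ?case by simp
  qed
  \<comment> \<open>With this rate \<open>exp (- \<omega> * t0) = 1 / 2\<close>. The factor 2 in
    \<open>M\<close> pays for rounding \<open>t / t0\<close> down to an integer, and the maximum
    secures \<open>1 \<le> M\<close>.\<close>
  define \<omega> where "\<omega> = ln 2 / t0"
  define M where "M = max 1 (2 * M0)"
  have "norm (T t) \<le> M * exp (- \<omega> * t)" if t: "0 \<le> t" for t
  proof -
    define n where "n = nat \<lfloor>t / t0\<rfloor>"
    have n: "real n \<le> t / t0" "t / t0 - 1 \<le> real n"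
      using t t0 by (auto simp: n_def of_nat_nat)
    have "norm (T (real n * t0 + (t - real n * t0))) \<le> (1 / 2) ^ n * M0"
      using n t0 by (intro pow) (simp add: field_simps)
    also have "(1 / 2 :: real) ^ n = exp (- ln 2 * real n)"
      by (simp add: exp_minus exp_of_nat2_mult power_one_over inverse_eq_divide)
    also have "\<dots> \<le> exp (- ln 2 * (t / t0 - 1))"
      using n by simp
    also have "\<dots> = 2 * exp (- \<omega> * t)"
      by (simp add: \<omega>_def algebra_simps exp_diff exp_minus exp_add field_simps)
    finally have "norm (T t) \<le> 2 * M0 * exp (- \<omega> * t)"
      using M0 by (simp add: mult_right_mono mult.commute)
    also have "\<dots> \<le> M * exp (- \<omega> * t)"
      by (intro mult_right_mono) (auto simp: M_def)
    finally show ?thesis .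
  qed
  moreover have "1 \<le> M" "0 < \<omega>" using t0 by (auto simp: M_def \<omega>_def)
  ultimately show thesis using that by blast
qed

text \<open>The classical renorming that absorbs the constant \<open>M\<close> of an exponential
  bound, so that decay can be iterated over arbitrarily short steps. The supremum is meaningful only
  if it is finite, which the bound assumed in the following context ensures.\<close>

definition growth_norm :: "real \<Rightarrow> (real \<Rightarrow> 'x::real_normed_vector \<Rightarrow>\<^sub>L 'x) \<Rightarrow> 'x \<Rightarrow> real" where
  "growth_norm \<omega> T x = (SUP t\<in>{0..}. exp (\<omega> * t) * norm (T t x))"

context
  fixes T :: "real \<Rightarrow> 'x::real_normed_vector \<Rightarrow>\<^sub>L 'x" and M \<omega> :: real
  assumes T: "c0_semigroup T"
    and stable: "\<And>t. 0 \<le> t \<Longrightarrow> norm (T t) \<le> M * exp (- \<omega> * t)"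
begin

lemma growth_norm_term_le:
  assumes "0 \<le> t"
  shows "exp (\<omega> * t) * norm (T t x) \<le> M * norm x"
proof -
  have "norm (T t x) \<le> norm (T t) * norm x" by (rule norm_blinfun)
  also have "\<dots> \<le> M * exp (- \<omega> * t) * norm x"
    using stable[OF assms] by (rule mult_right_mono) simp
  finally show ?thesis
    by (simp add: exp_minus field_simps)
qed

lemma growth_norm_upper:
  assumes "0 \<le> t"
  shows "exp (\<omega> * t) * norm (T t x) \<le> growth_norm \<omega> T x"
  unfolding growth_norm_def using assms growth_norm_term_le
  by (intro cSUP_upper) (auto intro!: bdd_aboveI2)

lemma growth_norm_least:
  assumes "\<And>t. 0 \<le> t \<Longrightarrow> exp (\<omega> * t) * norm (T t x) \<le> c"
  shows "growth_norm \<omega> T x \<le> c"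
  unfolding growth_norm_def using assms by (intro cSUP_least) auto

lemma norm_le_growth_norm: "norm x \<le> growth_norm \<omega> T x"
  using growth_norm_upper[of 0 x] by (simp add: c0_semigroup_0[OF T])

lemma growth_norm_le: "growth_norm \<omega> T x \<le> M * norm x"
  by (rule growth_norm_least) (rule growth_norm_term_le)

lemma growth_norm_triangle: "growth_norm \<omega> T (x + y) \<le> growth_norm \<omega> T x + growth_norm \<omega> T y"
proof (rule growth_norm_least)
  fix t :: real assume t: "0 \<le> t"
  have "exp (\<omega> * t) * norm (T t (x + y)) \<le> exp (\<omega> * t) * (norm (T t x) + norm (T t y))"
    by (simp add: blinfun.add_right norm_triangle_ineq)
  also have "\<dots> \<le> growth_norm \<omega> T x + growth_norm \<omega> T y"
    unfolding distrib_left by (intro add_mono growth_norm_upper t)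
  finally show "exp (\<omega> * t) * norm (T t (x + y)) \<le> growth_norm \<omega> T x + growth_norm \<omega> T y" .
qed

text \<open>Index shift: the terms for \<open>T k x\<close> are those for \<open>x\<close> at the
  times \<open>t + k\<close>, multiplied by \<open>exp (- \<omega> * k)\<close>. No constant
  \<open>M\<close> appears.\<close>

lemma growth_norm_semigroup:
  assumes "0 \<le> k"
  shows "growth_norm \<omega> T (T k x) \<le> exp (- \<omega> * k) * growth_norm \<omega> T x"
proof (rule growth_norm_least)
  fix t :: real assume t: "0 \<le> t"
  have "exp (\<omega> * t) * norm (T t (T k x)) = exp (- \<omega> * k) * (exp (\<omega> * (t + k)) * norm (T (t + k) x))"
    using c0_semigroup_add[OF T t assms, of x] by (simp add: exp_minus exp_add distrib_left)
  also have "\<dots> \<le> exp (- \<omega> * k) * growth_norm \<omega> T x"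
    using t assms by (intro mult_left_mono growth_norm_upper) auto
  finally show "exp (\<omega> * t) * norm (T t (T k x)) \<le> exp (- \<omega> * k) * growth_norm \<omega> T x" .
qed

lemma continuous_on_growth_norm: "continuous_on UNIV (growth_norm \<omega> T)"
proof -
  have "M \<ge> 0" using order_trans[OF norm_ge_zero stable[of 0]] by simp
  have le: "growth_norm \<omega> T x - growth_norm \<omega> T y \<le> M * dist x y" for x y
    using growth_norm_triangle[of "x - y" y] growth_norm_le[of "x - y"] by (simp add: dist_norm)
  have "M-lipschitz_on UNIV (growth_norm \<omega> T)"
  proof (rule lipschitz_onI)
    fix x y
    show "dist (growth_norm \<omega> T x) (growth_norm \<omega> T y) \<le> M * dist x y"
      using le[of x y] le[of y x] by (simp add: dist_real_def dist_commute abs_le_iff)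
  qed fact
  then show ?thesis by (rule lipschitz_on_continuous_on)
qed

end

section \<open>Mild solutions\<close>

lemma mild_solution_continuous_on:
  "\<lbrakk>mild_solution S Q f x0 u \<tau> x; ereal t < \<tau>\<rbrakk> \<Longrightarrow> continuous_on {0..t} x"
  unfolding mild_solution_def
  by (elim conjE continuous_on_subset) (auto intro: le_less_trans[of "ereal _" "ereal t"])

text \<open>At time 0 the integral is over a single point and vanishes, and \<open>S 0\<close> is
  the identity. Positivity of \<tau> puts time 0 into the interval of existence.\<close>

lemma mild_solution_initial:
  assumes S: "c0_semigroup S" and sol: "mild_solution S Q f x0 u \<tau> x" and \<tau>: "0 < \<tau>"
  shows "x 0 = x0"
proof -
  have "has_strong_bochner_integral (lebesgue_on {0..0}) (\<lambda>s. S (0 - s) (f (x s) (u s))) (x 0 - S 0 x0)"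
    using sol \<tau> unfolding mild_solution_def zero_ereal_def by blast
  then have "norm (x 0 - S 0 x0) \<le> 0 * norm (S (0 - 0) (f (x 0) (u 0)))"
    by (rule strong_bochner_integral_bound[rotated]) auto
  then show ?thesis by (simp add: c0_semigroup_0[OF S])
qed

text \<open>To first order in \<open>k\<close>, both \<open>x (s + k)\<close> and
  \<open>T k (x s)\<close> are compared with \<open>S k (x s) + k *\<^sub>R B (x s)\<close>: the
  former through the integral over \<open>{s<..s + k}\<close>, the latter through the limit of
  \<open>(T k y - S k y) /\<^sub>R k\<close>.\<close>

lemma mild_solution_increment:
  fixes S T :: "real \<Rightarrow> 'x::banach \<Rightarrow>\<^sub>L 'x"
  assumes S: "generates D A S" and T: "generates D (\<lambda>x. A x + blinfun_apply B x) T"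
    and M: "0 < \<delta>" "\<forall>t\<in>{0..\<delta>}. norm (S t) \<le> M"
    and sol: "mild_solution S Q f x0 u \<tau> x" and s: "0 \<le> s" "ereal s < \<tau>"
    and H: "\<forall>\<^sub>F r in at_right s. norm (f (x r) (u r) - B (x r)) \<le> H"
    and \<epsilon>: "0 < \<epsilon>"
  shows "\<forall>\<^sub>F k in at_right 0. norm (x (s + k) - T k (x s)) \<le> k * (M * H + \<epsilon>)"
proof -
  note CS = generatesD(1)[OF S]
  have M0: "0 \<le> M"
    using M norm_ge_zero[of "S 0"] by (meson atLeastAtMost_iff less_imp_le order_refl order_trans)
  obtain b where b: "s < b" "ereal b < \<tau>"
    using ereal_dense2[OF s(2)] by auto
  \<comment> \<open>The error \<epsilon> is spent in thirds: on the drift of \<open>x\<close> away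
    from \<open>x s\<close>, on \<open>S q\<close> differing from the identity at
    \<open>B (x s)\<close>, and on the difference quotient of \<open>T\<close> and
    \<open>S\<close>.\<close>
  define \<eta> where "\<eta> = \<epsilon> / (3 * (M * norm B + 1))"
  have MB: "0 < M * norm B + 1" using M0 by (simp add: add_nonneg_pos)
  then have \<eta>: "0 < \<eta>" "M * (norm B * \<eta>) \<le> \<epsilon> / 3"
    using \<epsilon> by (auto simp: \<eta>_def field_simps)
  have "continuous_on {s..b} x"
    by (rule continuous_on_subset[OF mild_solution_continuous_on[OF sol b(2)]]) (use s in auto)
  then have "(x \<longlongrightarrow> x s) (at_right s)"
    using b(1) by (rule continuous_on_Icc_at_rightD)
  then have "\<forall>\<^sub>F r in at_right s. norm (x r - x s) < \<eta>"
    using \<eta>(1) unfolding tendsto_iff dist_norm by blast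
  with H have "\<forall>\<^sub>F r in at_right s. norm (f (x r) (u r) - B (x r)) \<le> H \<and> norm (x r - x s) < \<eta>"
    by (rule eventually_conj)
  then obtain d where d: "s < d" "\<And>r. s < r \<Longrightarrow> r < d \<Longrightarrow>
      norm (f (x r) (u r) - B (x r)) \<le> H \<and> norm (x r - x s) < \<eta>"
    unfolding eventually_at_right_field by blast
  obtain d' where d': "0 < d'" "\<And>q. 0 \<le> q \<Longrightarrow> q < d' \<Longrightarrow> norm (S q (B (x s)) - B (x s)) < \<epsilon> / 3"
    using c0_semigroup_near_id[OF CS, of "\<epsilon> / 3" "B (x s)"] \<epsilon> by auto
  have "\<forall>\<^sub>F k in at_right 0. norm ((T k (x s) - S k (x s)) /\<^sub>R k - B (x s)) < \<epsilon> / 3"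
    using perturbed_semigroup_quotient_tendsto[OF S T, of "x s"] divide_pos_pos[OF \<epsilon> zero_less_numeral]
    unfolding tendsto_iff dist_norm by blast
  moreover have "\<forall>\<^sub>F k in at_right 0. k \<in> {0<..<min (min (b - s) (d - s)) (min d' \<delta>)}"
    using b d d' M by (intro eventually_at_right_real) auto
  ultimately show ?thesis
  proof eventually_elim
    case (elim k)
    then have k: "0 < k" "s + k < b" "s + k < d" "k < d'" "k < \<delta>" by auto
    let ?F = "\<lambda>t r. S (t - r) (f (x r) (u r))"
    have int: "has_strong_bochner_integral (lebesgue_on {0..t}) (?F t) (x t - S t x0)"
      if "0 \<le> t" "t < b" for t
      using sol that b(2) less_trans[of "ereal t" "ereal b" \<tau>] unfolding mild_solution_def by auto
    have H0: "0 \<le> H"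
      using order_trans[OF norm_ge_zero conjunct1[OF d(2)[of "s + k"]]] k by simp
    \<comment> \<open>The increment lemma is applied with \<open>L = S k\<close> and
      \<open>c = B (x s)\<close>. Since \<open>S (s + k) x0 = S k (S s x0)\<close>, the terms in
      \<open>x0\<close> drop out afterwards.\<close>
    have "norm ((x (s + k) - S (s + k) x0) - S k (x s - S s x0) - k *\<^sub>R B (x s))
        \<le> k * (M * H + 2 * \<epsilon> / 3)"
    proof (rule strong_bochner_integral_increment_bound[OF s(1) _ int int])
      fix r assume r: "r \<in> {0..s}"
      show "?F (s + k) r = S k (?F s r)"
        using r k c0_semigroup_add[OF CS, of k "s - r"] by (simp add: algebra_simps)
    next
      fix r assume r: "r \<in> {s<..s + k}"
      define q where "q = s + k - r"
      have q: "0 \<le> q" "q < d'" "norm (S q) \<le> M" using r k M by (auto simp: q_def)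
      have fr: "norm (f (x r) (u r) - B (x r)) \<le> H" "norm (x r - x s) < \<eta>"
        using d(2)[of r] r k by auto
      have "norm (S q (f (x r) (u r) - B (x r))) \<le> norm (S q) * norm (f (x r) (u r) - B (x r))"
        by (rule norm_blinfun)
      also have "\<dots> \<le> M * H"
        using q fr M0 by (intro mult_mono) auto
      finally have 1: "norm (S q (f (x r) (u r) - B (x r))) \<le> M * H" .
      have "norm (S q (B (x r - x s))) \<le> norm (S q) * norm (B (x r - x s))"
        by (rule norm_blinfun)
      also have "\<dots> \<le> M * (norm B * norm (x r - x s))"
        using q M0 by (intro mult_mono norm_blinfun) auto
      also have "\<dots> \<le> M * (norm B * \<eta>)"
        using fr M0 by (intro mult_left_mono) auto
      finally have 2: "norm (S q (B (x r - x s))) \<le> \<epsilon> / 3"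
        using \<eta> by simp
      have 3: "norm (S q (B (x s)) - B (x s)) \<le> \<epsilon> / 3"
        using d'(2)[of q] q by simp
      have "S q (f (x r) (u r)) - B (x s) =
          S q (f (x r) (u r) - B (x r)) + S q (B (x r - x s)) + (S q (B (x s)) - B (x s))"
        by (simp add: blinfun.diff_right)
      also have "norm \<dots> \<le> M * H + 2 * \<epsilon> / 3"
        using 1 2 3 norm_triangle_ineq[of "S q (f (x r) (u r) - B (x r)) + S q (B (x r - x s))"
            "S q (B (x s)) - B (x s)"]
          norm_triangle_ineq[of "S q (f (x r) (u r) - B (x r))" "S q (B (x r - x s))"] by linarith
      finally show "norm (?F (s + k) r - B (x s)) \<le> M * H + 2 * \<epsilon> / 3"
        by (simp add: q_def)
    qed (use s b k M0 H0 \<epsilon> in auto)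
    moreover have "S (s + k) x0 = S k (S s x0)"
      using c0_semigroup_add[OF CS, of k s x0] s k by (simp add: add.commute)
    ultimately have a: "norm (x (s + k) - S k (x s) - k *\<^sub>R B (x s)) \<le> k * (M * H + 2 * \<epsilon> / 3)"
      by (simp add: blinfun.diff_right)
    have "T k (x s) - S k (x s) - k *\<^sub>R B (x s) = k *\<^sub>R ((T k (x s) - S k (x s)) /\<^sub>R k - B (x s))"
      using k by (simp add: scaleR_diff_right)
    then have b: "norm (T k (x s) - S k (x s) - k *\<^sub>R B (x s)) \<le> k * (\<epsilon> / 3)"
      using elim(1) k by simp
    have "x (s + k) - T k (x s) =
        (x (s + k) - S k (x s) - k *\<^sub>R B (x s)) - (T k (x s) - S k (x s) - k *\<^sub>R B (x s))"
      by simp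
    also have "norm \<dots> \<le> k * (M * H + 2 * \<epsilon> / 3) + k * (\<epsilon> / 3)"
      using a b by (rule order_trans[OF norm_triangle_ineq4 add_mono])
    finally have "norm (x (s + k) - T k (x s)) \<le> k * (M * H + 2 * \<epsilon> / 3) + k * (\<epsilon> / 3)" .
    then show ?case by (simp add: algebra_simps)
  qed
qed

text \<open>At a contact with the barrier, \<open>growth_norm \<omega> T (x s) = P + K * v\<close>
  with \<open>P\<close> the decaying part. The solution then grows at a rate of at most
  \<open>- \<omega> * (P + K * v)\<close> plus the forcing, the barrier at rate
  \<open>- (\<omega> / 2) * P\<close>. The conditions on \<open>w\<close> and \<open>K\<close> limit
  the forcing to \<open>\<omega> / 4 * (P + K * v) + \<omega> / 2 * K * v\<close>, up to small
  errors, which leaves a slack of at least \<open>\<omega> / 4 * P\<close>.\<close>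

lemma mild_solution_growth_bound:
  fixes S T :: "real \<Rightarrow> 'x::banach \<Rightarrow>\<^sub>L 'x"
  assumes S: "generates D A S" and T: "generates D (\<lambda>x. A x + blinfun_apply B x) T"
    and N: "0 < \<delta>" "\<forall>t\<in>{0..\<delta>}. norm (S t) \<le> N"
    and M: "\<And>t. 0 \<le> t \<Longrightarrow> norm (T t) \<le> M * exp (- \<omega> * t)" and \<omega>: "0 < \<omega>"
    and f: "\<And>x u. \<lbrakk>(x, u) \<in> Q; norm x \<le> \<rho>; norm u \<le> \<rho>\<rbrakk> \<Longrightarrow>
      norm (f x u - B x) \<le> c * norm u + w * (norm x + norm u)"
    and c: "0 \<le> c" and w: "0 \<le> w" "M * N * w \<le> \<omega> / 4" and K: "0 \<le> K" "M * N * (c + w) \<le> \<omega> / 2 * K"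
    and sol: "mild_solution S Q f x0 u \<tau> x" and t: "0 \<le> t" "ereal t < \<tau>"
    and v: "\<And>s. 0 \<le> s \<Longrightarrow> norm (u s) \<le> v" "v \<le> \<rho>"
    and small: "growth_norm \<omega> T x0 + K * v < \<rho>"
  shows "growth_norm \<omega> T (x t) \<le> exp (- (\<omega> / 2) * t) * growth_norm \<omega> T x0 + K * v"
proof -
  note CT = generatesD(1)[OF T]
  let ?G = "growth_norm \<omega> T"
  note G = norm_le_growth_norm[OF CT M] growth_norm_le[OF CT M]
    growth_norm_triangle[OF CT M] growth_norm_semigroup[OF CT M]
  have M0: "0 \<le> M" using order_trans[OF norm_ge_zero M[of 0]] by simp
  have N0: "0 \<le> N"
    using N norm_ge_zero[of "S 0"] by (meson atLeastAtMost_iff less_imp_le order_refl order_trans)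
  have v0: "0 \<le> v" using order_trans[OF norm_ge_zero v(1)[of 0]] by simp
  have "0 \<le> ?G x0" using order_trans[OF norm_ge_zero G(1)] .
  have "0 < \<tau>" using t le_less_trans[of 0 "ereal t" \<tau>] by (simp add: zero_ereal_def)
  then have x0: "x 0 = x0" by (rule mild_solution_initial[OF generatesD(1)[OF S] sol])
  \<comment> \<open>The extra \<epsilon> keeps the decaying part of the barrier strictly positive
    even for \<open>x0 = 0\<close>, so the slack at a contact is strict. It is removed by a limit at
    the end.\<close>
  have bound: "?G (x t) \<le> exp (- (\<omega> / 2) * t) * (?G x0 + \<epsilon>) + K * v"
    if \<epsilon>: "0 < \<epsilon>" "?G x0 + \<epsilon> + K * v < \<rho>" for \<epsilon>
  proof (rule continuous_barrier_le[of 0 t "\<lambda>s. ?G (x s)"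
        "\<lambda>s. exp (- (\<omega> / 2) * s) * (?G x0 + \<epsilon>) + K * v"])
    show "continuous_on {0..t} (\<lambda>s. ?G (x s))"
      by (rule continuous_on_compose2[OF continuous_on_growth_norm[OF CT M]
            mild_solution_continuous_on[OF sol t(2)]]) auto
    show "continuous_on {0..t} (\<lambda>s. exp (- (\<omega> / 2) * s) * (?G x0 + \<epsilon>) + K * v)"
      by (intro continuous_intros)
    show "?G (x 0) \<le> exp (- (\<omega> / 2) * 0) * (?G x0 + \<epsilon>) + K * v"
      using \<epsilon> K v0 x0 by simp
  next
    fix s assume s: "0 \<le> s" "s < t"
      and eq: "?G (x s) = exp (- (\<omega> / 2) * s) * (?G x0 + \<epsilon>) + K * v"
    define P where "P = exp (- (\<omega> / 2) * s) * (?G x0 + \<epsilon>)"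
    have P: "0 < P" using \<epsilon> \<open>0 \<le> ?G x0\<close> by (simp add: P_def)
    have "P \<le> 1 * (?G x0 + \<epsilon>)"
      unfolding P_def using \<omega> s \<epsilon> \<open>0 \<le> ?G x0\<close> by (intro mult_right_mono) auto
    then have P\<rho>: "P + K * v < \<rho>" using \<epsilon> by simp
    have xs: "norm (x s) \<le> P + K * v" using G(1)[of "x s"] eq by (simp add: P_def)
    have s\<tau>: "ereal s < \<tau>" using s t less_trans[of "ereal s" "ereal t" \<tau>] by simp
    \<comment> \<open>The first entry keeps nearby states within radius \<rho>, where the estimate
      on \<open>f\<close> is available. The second makes the total error
      \<open>\<eta> * (\<omega> / 4 + M)\<close> at most \<open>\<omega> / 8 * P\<close>, below the
      slack.\<close>
    define \<eta> where "\<eta> = min (\<rho> - (P + K * v)) (\<omega> / 4 * P / (2 * (\<omega> / 4 + M)))"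
    have \<omega>M: "0 < \<omega> / 4 + M" using \<omega> M0 by simp
    have \<eta>: "0 < \<eta>" "P + K * v + \<eta> \<le> \<rho>"
      using P\<rho> P \<omega> \<omega>M unfolding \<eta>_def by auto
    have "\<eta> * (\<omega> / 4 + M) \<le> \<omega> / 4 * P / (2 * (\<omega> / 4 + M)) * (\<omega> / 4 + M)"
      using \<omega>M unfolding \<eta>_def by (intro mult_right_mono) auto
    also have "\<dots> = \<omega> / 8 * P"
      using \<omega>M by (simp add: field_simps)
    also have "\<dots> < \<omega> / 4 * P"
      using P \<omega> by simp
    finally have \<eta>': "\<eta> * (\<omega> / 4 + M) < \<omega> / 4 * P" .
    define H where "H = (c + w) * v + w * (P + K * v + \<eta>)"
    have "continuous_on {s..t} x"
      using mild_solution_continuous_on[OF sol t(2)] by (rule continuous_on_subset) (use s in auto)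
    then have "(x \<longlongrightarrow> x s) (at_right s)"
      using s(2) by (rule continuous_on_Icc_at_rightD)
    then have "\<forall>\<^sub>F r in at_right s. norm (x r - x s) < \<eta>"
      using \<eta>(1) unfolding tendsto_iff dist_norm by blast
    moreover have "\<forall>\<^sub>F r in at_right s. r \<in> {s<..<t}"
      using s by (intro eventually_at_right_real)
    ultimately have ev_H: "\<forall>\<^sub>F r in at_right s. norm (f (x r) (u r) - B (x r)) \<le> H"
    proof eventually_elim
      case (elim r)
      have xr: "norm (x r) \<le> P + K * v + \<eta>"
        using elim(1) xs norm_triangle_sub[of "x r" "x s"] by linarith
      have ur: "norm (u r) \<le> v" using v elim s by simp
      have "ereal r < \<tau>" using elim t less_trans[of "ereal r" "ereal t" \<tau>] by simp
      then have "(x r, u r) \<in> Q"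
        using sol elim s unfolding mild_solution_def by auto
      then have "norm (f (x r) (u r) - B (x r)) \<le> c * norm (u r) + w * (norm (x r) + norm (u r))"
        using xr ur \<eta> v by (intro f) auto
      also have "\<dots> \<le> c * v + w * ((P + K * v + \<eta>) + v)"
        using xr ur c w by (intro add_mono mult_left_mono) auto
      finally show ?case by (simp add: H_def algebra_simps)
    qed
    \<comment> \<open>The forcing rate measured in \<open>growth_norm\<close>:
      \<open>mild_solution_increment\<close> gives \<open>N * H + \<eta>\<close> in the original
      norm, and \<open>M\<close> converts it.\<close>
    define N' where "N' = M * (N * H + \<eta>)"
    have "M * N * ((c + w) * v) \<le> \<omega> / 2 * K * v"
      using K(2) v0 mult_right_mono[of "M * N * (c + w)" "\<omega> / 2 * K" v] by (simp add: mult.assoc)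
    moreover have "M * N * (w * (P + K * v + \<eta>)) \<le> \<omega> / 4 * (P + K * v + \<eta>)"
      using w(2) P K v0 \<eta> mult_right_mono[of "M * N * w" "\<omega> / 4" "P + K * v + \<eta>"]
      by (simp add: mult.assoc)
    moreover have "N' = M * N * ((c + w) * v) + M * N * (w * (P + K * v + \<eta>)) + M * \<eta>"
      by (simp add: N'_def H_def algebra_simps)
    ultimately have "N' \<le> \<omega> / 2 * K * v + \<omega> / 4 * (P + K * v + \<eta>) + M * \<eta>"
      by linarith
    also have "\<dots> = \<omega> / 2 * K * v + \<omega> / 4 * (P + K * v) + \<eta> * (\<omega> / 4 + M)"
      by (simp add: algebra_simps add_divide_distrib)
    also have "\<dots> < \<omega> / 2 * K * v + \<omega> / 4 * (P + K * v) + \<omega> / 4 * P"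
      using \<eta>' by simp
    \<comment> \<open>The two sides differ by \<open>\<omega> / 4 * K * v\<close>, which is
      nonnegative.\<close>
    also have "\<dots> \<le> \<omega> * (P + K * v) - \<omega> / 2 * P"
      using mult_nonneg_nonneg[OF less_imp_le[OF \<omega>] mult_nonneg_nonneg[OF K(1) v0]]
      by (simp add: field_simps)
    finally have N': "0 < \<omega> * (P + K * v) - \<omega> / 2 * P - N'" by simp
    \<comment> \<open>The barrier at \<open>s + k\<close> minus the upper bound for the solution
      there. It vanishes at 0 and has positive derivative there, so it is positive for small
      \<open>k > 0\<close>.\<close>
    define \<psi> where "\<psi> k = exp (- (\<omega> / 2) * k) * P + K * v - exp (- \<omega> * k) * (P + K * v) - k * N'" for k
    have "(\<psi> has_real_derivative (\<omega> * (P + K * v) - \<omega> / 2 * P - N')) (at 0)"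
      unfolding \<psi>_def by (auto intro!: derivative_eq_intros simp: algebra_simps)
    then obtain d where d: "0 < d" "\<And>k. 0 < k \<Longrightarrow> k < d \<Longrightarrow> \<psi> 0 < \<psi> (0 + k)"
      using DERIV_pos_inc_right[OF _ N'] by blast
    have "\<forall>\<^sub>F k in at_right 0. norm (x (s + k) - T k (x s)) \<le> k * (N * H + \<eta>)"
      by (rule mild_solution_increment[OF S T N sol s(1) s\<tau> ev_H \<eta>(1)])
    moreover have "\<forall>\<^sub>F k in at_right 0. k \<in> {0<..<d}"
      using d by (intro eventually_at_right_real)
    ultimately show "\<forall>\<^sub>F k in at_right 0. ?G (x (s + k))
        \<le> exp (- (\<omega> / 2) * (s + k)) * (?G x0 + \<epsilon>) + K * v"
    proof eventually_elim
      case (elim k)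
      have "?G (x (s + k)) \<le> ?G (T k (x s)) + ?G (x (s + k) - T k (x s))"
        using G(3)[of "T k (x s)" "x (s + k) - T k (x s)"] by simp
      also have "\<dots> \<le> exp (- \<omega> * k) * ?G (x s) + M * norm (x (s + k) - T k (x s))"
        using elim by (intro add_mono G) auto
      also have "\<dots> \<le> exp (- \<omega> * k) * (P + K * v) + M * (k * (N * H + \<eta>))"
        unfolding eq P_def using elim M0 by (intro add_left_mono mult_left_mono) auto
      also have "\<dots> = exp (- \<omega> * k) * (P + K * v) + k * N'"
        by (simp add: N'_def)
      also have "\<dots> \<le> exp (- (\<omega> / 2) * k) * P + K * v"
        using d(2)[of k] elim by (simp add: \<psi>_def)
      also have "\<dots> = exp (- (\<omega> / 2) * (s + k)) * (?G x0 + \<epsilon>) + K * v"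
      proof -
        have "exp (- (\<omega> / 2) * (s + k)) = exp (- (\<omega> / 2) * k) * exp (- (\<omega> / 2) * s)"
          unfolding exp_add[symmetric] by (simp add: algebra_simps)
        then show ?thesis by (simp only: P_def mult.assoc)
      qed
      finally show ?case .
    qed
  qed (use t in auto)
  have "((\<lambda>\<epsilon>. exp (- (\<omega> / 2) * t) * (?G x0 + \<epsilon>) + K * v) \<longlongrightarrow>
      exp (- (\<omega> / 2) * t) * (?G x0 + 0) + K * v) (at_right 0)"
    by (intro tendsto_intros)
  moreover have "\<forall>\<^sub>F \<epsilon> in at_right 0. ?G (x t) \<le> exp (- (\<omega> / 2) * t) * (?G x0 + \<epsilon>) + K * v"
  proof -
    have "\<forall>\<^sub>F \<epsilon> in at_right 0. \<epsilon> \<in> {0<..<\<rho> - (?G x0 + K * v)}"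
      using small by (intro eventually_at_right_real) simp
    then show ?thesis by eventually_elim (rule bound, auto)
  qed
  ultimately show ?thesis
    using tendsto_lowerbound[of _ "exp (- (\<omega> / 2) * t) * (?G x0 + 0) + K * v" "at_right 0"] by force
qed

section \<open>Local input-to-state stability\<close>

lemma norm_input_le:
  "\<lbrakk>input_space Uc; u \<in> Uc; 0 \<le> s\<rbrakk> \<Longrightarrow> norm (u s) \<le> input_norm u"
  unfolding input_norm_def input_space_def
  by (intro cSUP_upper) (auto intro: bounded_imp_bdd_above simp: bounded_norm_comp)

lemma class_KL_nonneg: "\<lbrakk>\<beta> \<in> class_KL; 0 \<le> r; 0 \<le> t\<rbrakk> \<Longrightarrow> 0 \<le> \<beta> r t"
proof -
  assume "\<beta> \<in> class_KL" "0 \<le> r" "0 \<le> t"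
  then have "strict_mono_on {0..} (\<lambda>r. \<beta> r t)" "\<beta> 0 t = 0"
    by (auto simp: class_KL_def class_K_def)
  then show ?thesis
    using \<open>0 \<le> r\<close> strict_mono_onD[of "{0..}" "\<lambda>r. \<beta> r t" 0 r] by (cases "r = 0") auto
qed

text \<open>For zero input the solution is \<open>T t x\<close> and the gain term vanishes, so the
  ISS estimate bounds \<open>norm (T t x)\<close> by \<open>\<beta> (norm x) t\<close>. Normalising
  \<open>x\<close> turns this into the operator bound \<open>\<beta> 1 t\<close>, which tends to 0
  and, decreasing in \<open>t\<close>, stays below \<open>\<beta> 1 0\<close>.\<close>

lemma linear_ISS_imp_exponentially_stable:
  fixes T :: "real \<Rightarrow> 'x::real_normed_vector \<Rightarrow>\<^sub>L 'x" and C :: "'u::real_normed_vector \<Rightarrow>\<^sub>L 'x"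
  assumes T: "c0_semigroup T" and Uc: "input_space Uc"
    and sys: "control_system T UNIV (\<lambda>x u. C u) Uc \<phi> tm" and iss: "ISS Uc \<phi> tm"
  obtains M \<omega> where "1 \<le> M" "0 < \<omega>" "\<forall>t\<ge>0. norm (T t) \<le> M * exp (- \<omega> * t)"
proof -
  obtain \<beta> \<gamma> where \<beta>: "\<beta> \<in> class_KL" and \<gamma>: "\<gamma> \<in> class_K"
    and est: "\<And>x0 u. u \<in> Uc \<Longrightarrow> iss_estimate \<phi> tm \<beta> \<gamma> x0 u"
    using iss unfolding ISS_def by blast
  let ?z = "(\<lambda>_. 0) :: real \<Rightarrow> 'u"
  have z: "?z \<in> Uc" using Uc by (simp add: input_space_def)
  have z0: "\<gamma> (input_norm ?z) = 0" using \<gamma> by (simp add: input_norm_def class_K_def)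
  have le: "norm (T t x) \<le> \<beta> (norm x) t" if t: "0 \<le> t" for t x
  proof -
    have tm: "ereal t < tm x ?z" and \<phi>: "norm (\<phi> t x ?z) \<le> \<beta> (norm x) t"
      using est[OF z, of x] t z0 unfolding iss_estimate_def by auto
    have "mild_solution T UNIV (\<lambda>x u. C u) x ?z (tm x ?z) (\<lambda>t. \<phi> t x ?z)"
      using sys z unfolding control_system_def by blast
    then have "has_strong_bochner_integral (lebesgue_on {0..t}) (\<lambda>s. T (t - s) (C 0)) (\<phi> t x ?z - T t x)"
      using t tm unfolding mild_solution_def by blast
    then have "norm (\<phi> t x ?z - T t x) \<le> t * 0"
      by (rule strong_bochner_integral_bound[OF t]) (auto simp: blinfun.zero_right)
    then show ?thesis using \<phi> by simp
  qed
  have \<beta>0: "0 \<le> \<beta> 1 t" if "0 \<le> t" for t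
    using class_KL_nonneg[OF \<beta> _ that, of 1] by simp
  have nT: "norm (T t) \<le> \<beta> 1 t" if t: "0 \<le> t" for t
  proof (rule norm_blinfun_bound)
    fix x
    show "norm (T t x) \<le> \<beta> 1 t * norm x"
      using le[OF t, of "x /\<^sub>R norm x"]
      by (cases "x = 0") (auto simp: blinfun.zero_right blinfun.scaleR_right field_simps)
  qed (rule \<beta>0[OF t])
  have anti: "antimono_on {0..} (\<beta> 1)" and lim: "(\<beta> 1 \<longlongrightarrow> 0) at_top"
    using \<beta> unfolding class_KL_def by auto
  have bd: "norm (T t) \<le> \<beta> 1 0" if "0 \<le> t" for t
    using nT[OF that] monotone_onD[OF anti, of 0 t] that by simp
  have "((\<lambda>t. norm (T t)) \<longlongrightarrow> 0) at_top"
  proof (rule tendsto_sandwich[OF _ _ tendsto_const lim])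
    show "\<forall>\<^sub>F t in at_top. norm (T t) \<le> \<beta> 1 t"
      using eventually_ge_at_top[of 0] by eventually_elim (rule nT)
  qed simp
  with T bd show thesis
    using c0_semigroup_exponentially_stable that by blast
qed

theorem theorem2:
  fixes A :: "'x::banach \<Rightarrow> 'x" and D :: "'x set"
    and B :: "'x \<Rightarrow>\<^sub>L 'x" and C :: "'u::real_normed_vector \<Rightarrow>\<^sub>L 'x"
    and f g :: "'x \<Rightarrow> 'u \<Rightarrow> 'x" and Q :: "('x \<times> 'u) set"
    and S T :: "real \<Rightarrow> 'x \<Rightarrow>\<^sub>L 'x"
    and Uc :: "(real \<Rightarrow> 'u) set"
    and \<phi> \<phi>_lin :: "real \<Rightarrow> 'x \<Rightarrow> (real \<Rightarrow> 'u) \<Rightarrow> 'x"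
    and tm tm_lin :: "'x \<Rightarrow> (real \<Rightarrow> 'u) \<Rightarrow> ereal"
  assumes "generates D A S"
    and "generates D (\<lambda>x. A x + B x) T"
    and "open Q" and "(0, 0) \<in> Q" and "f 0 0 = 0"
    and "\<And>x u. (x, u) \<in> Q \<Longrightarrow> f x u = B x + C u + g x u"
    and "\<And>w::real. w > 0 \<Longrightarrow>
           \<exists>\<rho>>0. \<forall>x u. (x, u) \<in> Q \<and> norm x \<le> \<rho> \<and> norm u \<le> \<rho> \<longrightarrow>
             norm (g x u) \<le> w * (norm x + norm u)"
    and "input_space Uc"
    and "control_system S Q f Uc \<phi> tm"
    and "control_system T UNIV (\<lambda>x u. C u) Uc \<phi>_lin tm_lin"
    and "ISS Uc \<phi>_lin tm_lin"
  shows "LISS Uc \<phi> tm"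
proof -
  note S = assms(1) and T = assms(2) and Uc = assms(8) and sys = assms(9)
  note CT = generatesD(1)[OF T]
  obtain M \<omega> where M: "1 \<le> M" and \<omega>: "0 < \<omega>"
    and "\<forall>t\<ge>0. norm (T t) \<le> M * exp (- \<omega> * t)"
    by (rule linear_ISS_imp_exponentially_stable[OF CT Uc assms(10,11)])
  then have stable: "\<And>t. 0 \<le> t \<Longrightarrow> norm (T t) \<le> M * exp (- \<omega> * t)" by blast
  obtain N \<delta> where N: "1 \<le> N" "0 < \<delta>" "\<forall>t\<in>{0..\<delta>}. norm (S t) \<le> N"
    by (rule c0_semigroup_bounded_near_0[OF generatesD(1)[OF S]])
  \<comment> \<open>\<open>w\<close> and then \<open>K\<close> are chosen so that the two smallness
    conditions of \<open>mild_solution_growth_bound\<close> hold with equality.\<close>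
  define w where "w = \<omega> / (4 * M * N)"
  have w: "0 < w" "M * N * w \<le> \<omega> / 4"
    using \<omega> M N(1) by (auto simp: w_def)
  define K where "K = 2 * M * N * (norm C + w) / \<omega>"
  have K: "0 < K" "M * N * (norm C + w) \<le> \<omega> / 2 * K"
    using \<omega> M N(1) w(1) by (auto simp: K_def add_nonneg_pos)
  obtain \<rho>1 where \<rho>1: "0 < \<rho>1" "\<And>x u. \<lbrakk>(x, u) \<in> Q; norm x \<le> \<rho>1; norm u \<le> \<rho>1\<rbrakk> \<Longrightarrow>
      norm (g x u) \<le> w * (norm x + norm u)"
    using assms(7)[OF w(1)] by blast
  obtain r where r: "0 < r" "ball (0, 0) r \<subseteq> Q"
    using assms(3,4) unfolding open_contains_ball by blast
  \<comment> \<open>The norm of a pair is at most the sum of the norms, so state, input and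
    displacement may each use a third of \<open>r\<close>. The uniform radius \<open>r / 3\<close>
    is what \<open>uniformly_inside\<close> asks for.\<close>
  have inQ: "ball (x, u) (r / 3) \<subseteq> Q" if "norm x \<le> r / 3" "norm u \<le> r / 3" for x u
  proof
    fix p assume p: "p \<in> ball (x, u) (r / 3)"
    have "norm p \<le> norm (x, u) + norm (p - (x, u))"
      by (rule norm_triangle_sub)
    also have "\<dots> < (norm x + norm u) + r / 3"
      using p norm_Pair_le[of x u] by (intro add_le_less_mono) (auto simp: dist_norm norm_minus_commute)
    finally have "norm p < r" using that by simp
    then show "p \<in> Q" using r(2) by (auto simp: dist_norm zero_prod_def[symmetric])
  qed
  define \<rho> where "\<rho> = min \<rho>1 (r / 3)"
  have \<rho>: "0 < \<rho>" using \<rho>1 r by (simp add: \<rho>_def)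
  have f: "norm (f x u - B x) \<le> norm C * norm u + w * (norm x + norm u)"
    if "(x, u) \<in> Q" "norm x \<le> \<rho>" "norm u \<le> \<rho>" for x u
  proof -
    have "norm (f x u - B x) \<le> norm (C u) + norm (g x u)"
      using assms(6)[OF that(1)] norm_triangle_ineq[of "C u" "g x u"] by (simp add: add.assoc)
    also have "\<dots> \<le> norm C * norm u + w * (norm x + norm u)"
      using that by (intro add_mono norm_blinfun \<rho>1) (auto simp: \<rho>_def)
    finally show ?thesis .
  qed
  \<comment> \<open>Both \<open>M * norm x0\<close> and \<open>K * input_norm u\<close> are then at
    most \<open>\<rho> / 4\<close>, so the barrier stays at or below \<open>\<rho> / 2\<close>. The
    minimum in \<open>\<rho>u\<close> also keeps the inputs themselves within radius \<rho>.\<close>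
  define \<rho>x where "\<rho>x = \<rho> / (4 * M)"
  define \<rho>u where "\<rho>u = min \<rho> (\<rho> / (4 * K))"
  define \<beta> where "\<beta> r t = M * exp (- (\<omega> / 2) * t) * r" for r t
  define \<gamma> where "\<gamma> r = K * r" for r
  have "\<beta> \<in> class_KL"
  proof -
    have "((\<lambda>t. M * exp (- (\<omega> / 2) * t) * r) \<longlongrightarrow> 0) at_top" for r
    proof -
      have "filterlim (\<lambda>t. - (\<omega> / 2) * t) at_bot at_top"
        using \<omega> by (intro filterlim_tendsto_neg_mult_at_bot[OF tendsto_const]) (auto intro: filterlim_ident)
      then have "((\<lambda>t. exp (- (\<omega> / 2) * t)) \<longlongrightarrow> 0) at_top"
        by (rule filterlim_compose[OF exp_at_bot])
      then show ?thesis
        using tendsto_mult_left_zero tendsto_mult_right_zero by blast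
    qed
    moreover have "antimono_on {0..} (\<lambda>t. M * exp (- (\<omega> / 2) * t) * r)" if "0 < r" for r
      using that M \<omega> by (intro monotone_onI mult_right_mono mult_left_mono) auto
    ultimately show ?thesis
      using M unfolding \<beta>_def class_KL_def class_K_def
      by (auto intro!: continuous_intros strict_mono_onI)
  qed
  moreover have "\<gamma> \<in> class_K"
    using K unfolding \<gamma>_def class_K_def by (auto intro!: continuous_intros strict_mono_onI)
  moreover have "0 < \<rho>x" "0 < \<rho>u"
    using \<rho> M K by (auto simp: \<rho>x_def \<rho>u_def)
  moreover have "iss_estimate \<phi> tm \<beta> \<gamma> x0 u"
    if u: "u \<in> Uc" and x0: "norm x0 \<le> \<rho>x" and nu: "input_norm u \<le> \<rho>u" for x0 u
  proof -
    let ?v = "input_norm u" and ?x = "\<lambda>t. \<phi> t x0 u" and ?\<tau> = "tm x0 u"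
    have v: "norm (u s) \<le> ?v" if "0 \<le> s" for s
      using norm_input_le[OF Uc u that] .
    have v\<rho>: "?v \<le> \<rho>" using nu by (simp add: \<rho>u_def)
    have Mx: "M * norm x0 \<le> \<rho> / 4"
      using x0 M by (simp add: \<rho>x_def field_simps)
    have Kv: "K * ?v \<le> \<rho> / 4"
      using nu K by (simp add: \<rho>u_def field_simps)
    have small: "growth_norm \<omega> T x0 + K * ?v < \<rho>"
      using growth_norm_le[OF CT stable, of x0] Mx Kv \<rho> by simp
    have sol: "mild_solution S Q f x0 u ?\<tau> ?x"
      and ex: "uniformly_inside Q {0} (\<lambda>_. x0) u \<Longrightarrow> 0 < ?\<tau>"
      and bic: "\<lbrakk>0 < ?\<tau>; ?\<tau> < \<infinity>; uniformly_inside Q {t. 0 \<le> t \<and> ereal t < ?\<tau>} ?x u\<rbrakk> \<Longrightarrow>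
        \<not> bounded (?x ` {t. 0 \<le> t \<and> ereal t < ?\<tau>})"
      using sys u unfolding control_system_def by blast+
    have est: "norm (?x t) \<le> \<beta> (norm x0) t + \<gamma> ?v" if t: "0 \<le> t" "ereal t < ?\<tau>" for t
    proof -
      have "norm (?x t) \<le> growth_norm \<omega> T (?x t)"
        by (rule norm_le_growth_norm[OF CT stable])
      also have "\<dots> \<le> exp (- (\<omega> / 2) * t) * growth_norm \<omega> T x0 + K * ?v"
        by (rule mild_solution_growth_bound[OF S T N(2,3) stable \<omega> f norm_ge_zero less_imp_le[OF w(1)] w(2)
              less_imp_le[OF K(1)] K(2) sol t v v\<rho> small])
      also have "\<dots> \<le> exp (- (\<omega> / 2) * t) * (M * norm x0) + K * ?v"
        by (intro add_right_mono mult_left_mono growth_norm_le[OF CT stable]) auto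
      finally show ?thesis by (simp add: \<beta>_def \<gamma>_def mult.commute mult.left_commute)
    qed
    have bdd: "norm (?x t) \<le> \<rho>" if t: "0 \<le> t" "ereal t < ?\<tau>" for t
    proof -
      have "exp (- (\<omega> / 2) * t) * (M * norm x0) \<le> 1 * (M * norm x0)"
        using t \<omega> M by (intro mult_right_mono) auto
      then have "\<beta> (norm x0) t \<le> M * norm x0"
        by (simp add: \<beta>_def mult.commute mult.left_commute)
      then show ?thesis using est[OF t] Mx Kv \<rho> by (simp add: \<gamma>_def)
    qed
    \<comment> \<open>Stated for a general \<open>y\<close> because it is used twice: with the
      constant \<open>x0\<close> for local existence, and with the trajectory for continuation. The
      value \<open>r / 3\<close> serves as radius and also as length of the time window, an
      arbitrary choice since the input bound holds at all times.\<close>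
    have inside: "uniformly_inside Q I y u" if "\<And>s. s \<in> I \<Longrightarrow> 0 \<le> s \<and> norm (y s) \<le> \<rho>" for I y
      unfolding uniformly_inside_def
    proof (intro exI[of _ "r / 3"] conjI ballI)
      fix s \<sigma> :: real assume "s \<in> I" "\<sigma> \<in> {s..<s + r / 3}"
      then show "ball (y s, u \<sigma>) (r / 3) \<subseteq> Q"
        using that[of s] v[of \<sigma>] v\<rho> by (intro inQ) (auto simp: \<rho>_def)
    qed (use r in auto)
    have "norm x0 \<le> M * norm x0" using M by (simp add: mult_le_cancel_right1)
    then have "0 < ?\<tau>"
      using Mx \<rho> by (intro ex inside) auto
    moreover have "bounded (?x ` {t. 0 \<le> t \<and> ereal t < ?\<tau>})"
      using bdd by (auto simp: bounded_iff)
    moreover have "uniformly_inside Q {t. 0 \<le> t \<and> ereal t < ?\<tau>} ?x u"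
      using bdd by (intro inside) auto
    \<comment> \<open>A finite maximal existence time would force an unbounded trajectory, as the
      trajectory stays uniformly inside \<open>Q\<close>; but it is bounded by \<rho>.\<close>
    ultimately have "\<not> ?\<tau> < \<infinity>"
      using bic by blast
    then have "?\<tau> = \<infinity>" by simp
    then show ?thesis
      using est unfolding iss_estimate_def by simp
  qed
  ultimately show ?thesis
    unfolding LISS_def by blast
qed

end
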